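(* Let $S\subseteq\Sigma_{io}^*$ be a regular language with $\mathit{shift}(S)<\infty$ and let $T\subseteq\Sigma_{io}^*$ be an arbitrary regular language. Then it is decidable whether there exists a language $U\subseteq T$ recognized by a sequential DFA such that $[\![U]\!]$ is a uniformization of $[\![S]\!]$.
   Context: $\Sigma_{io}=\{1,2\}\times\Sigma$ for a finite alphabet $\Sigma$, $\Sigma_i=\{1\}\times\Sigma$, $\Sigma_o=\{2\}\times\Sigma$. $[\![w]\!]=(\pi_i(w),\pi_o(w))$ where $\pi_i$ keeps the letters $a$ of pairs $(1,a)$ and erases the others, $\pi_o$ keeps the letters $a$ of pairs $(2,a)$ and erases the others; $[\![S]\!]=\{[\![w]\!]:w\in S\}$. For $w=(i_1,a_1)\cdots(i_m,a_m)$, a shift is a position $j<m$ with $i_j\ne i_{j+1}$; $\mathit{shift}(w)$ is the number of shifts and $\mathit{shift}(S)=\sup_{w\in S}\mathit{shift}(w)$. A uniformization of $R$ is a functional $R_f\subseteq R$ with $\mathrm{dom}(R_f)=\mathrm{dom}(R)$. A DFA over $\Sigma_{io}$ is sequential if the states with outgoing $\Sigma_i$-transitions and the states with outgoing $\Sigma_o$-transitions partition the state set and every state of the latter kind has at most one outgoing transition. *)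

theory Defs
  imports Main "HOL-Library.Nat_Bijection"
begin

type_synonym letter = "nat \<times> nat"   \<comment> \<open>(direction 1 = input / 2 = output, symbol)\<close>

definition Sigma_io :: "nat \<Rightarrow> letter set" where
  "Sigma_io k = {1,2} \<times> {0..<k}"

definition proj_i :: "letter list \<Rightarrow> nat list" where
  "proj_i w = map snd (filter (\<lambda>x. fst x = 1) w)"

definition proj_o :: "letter list \<Rightarrow> nat list" where
  "proj_o w = map snd (filter (\<lambda>x. fst x = 2) w)"

definition sem :: "letter list \<Rightarrow> nat list \<times> nat list" where
  "sem w = (proj_i w, proj_o w)"

definition sem_set :: "letter list set \<Rightarrow> (nat list \<times> nat list) set" where
  "sem_set S = sem ` S"

definition shift :: "letter list \<Rightarrow> nat" where
  "shift w = card {j. Suc j < length w \<and> fst (w ! j) \<noteq> fst (w ! Suc j)}"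

definition finite_shift :: "letter list set \<Rightarrow> bool" where
  "finite_shift S \<longleftrightarrow> (\<exists>N. \<forall>w\<in>S. shift w \<le> N)"

definition uniformization :: "('x \<times> 'y) set \<Rightarrow> ('x \<times> 'y) set \<Rightarrow> bool" where
  "uniformization Rf R \<longleftrightarrow> Rf \<subseteq> R \<and> single_valued Rf \<and> Domain Rf = Domain R"

type_synonym dfa = "nat set \<times> nat \<times> (nat \<Rightarrow> letter \<Rightarrow> nat option) \<times> nat set"

fun states :: "dfa \<Rightarrow> nat set" where "states (Q, q0, \<delta>, F) = Q"
fun init :: "dfa \<Rightarrow> nat" where "init (Q, q0, \<delta>, F) = q0"
fun delta :: "dfa \<Rightarrow> nat \<Rightarrow> letter \<Rightarrow> nat option" where "delta (Q, q0, \<delta>, F) = \<delta>"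
fun finals :: "dfa \<Rightarrow> nat set" where "finals (Q, q0, \<delta>, F) = F"

definition dfa_wf :: "nat \<Rightarrow> dfa \<Rightarrow> bool" where
  "dfa_wf k A \<longleftrightarrow> finite (states A) \<and> init A \<in> states A \<and> finals A \<subseteq> states A \<and>
     (\<forall>q x p. delta A q x = Some p \<longrightarrow> q \<in> states A \<and> x \<in> Sigma_io k \<and> p \<in> states A)"

fun steps :: "(nat \<Rightarrow> letter \<Rightarrow> nat option) \<Rightarrow> nat \<Rightarrow> letter list \<Rightarrow> nat option" where
  "steps \<delta> q [] = Some q"
| "steps \<delta> q (x # xs) = (case \<delta> q x of None \<Rightarrow> None | Some p \<Rightarrow> steps \<delta> p xs)"

definition lang :: "dfa \<Rightarrow> letter list set" where
  "lang A = {w. \<exists>q. steps (delta A) (init A) w = Some q \<and> q \<in> finals A}"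

definition sequential :: "dfa \<Rightarrow> bool" where
  "sequential A \<longleftrightarrow> (\<exists>Qi Qo. Qi \<union> Qo = states A \<and> Qi \<inter> Qo = {} \<and>
     (\<forall>q\<in>Qi. \<forall>x. delta A q x \<noteq> None \<longrightarrow> fst x = 1) \<and>
     (\<forall>q\<in>Qo. \<forall>x. delta A q x \<noteq> None \<longrightarrow> fst x = 2) \<and>
     (\<forall>q\<in>Qo. \<forall>x y. delta A q x \<noteq> None \<and> delta A q y \<noteq> None \<longrightarrow> x = y))"

text \<open>A code (n, q0, F, tb) describes states {0..<n}, initial state q0, final states F,
  and the transition table tb: entry at index q*(2*k) + (i-1)*k + a is the target of
  letter (i,a) from q; an entry \<ge> n means "no transition".\<close>
type_synonym dfa_code = "nat \<times> nat \<times> nat list \<times> nat list"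

fun code_valid :: "nat \<Rightarrow> dfa_code \<Rightarrow> bool" where
  "code_valid k (n, q0, F, tb) \<longleftrightarrow> q0 < n \<and> (\<forall>q\<in>set F. q < n) \<and> length tb = n * (2 * k)"

fun dfa_of :: "nat \<Rightarrow> dfa_code \<Rightarrow> dfa" where
  "dfa_of k (n, q0, F, tb) =
     ({0..<n}, q0,
      (\<lambda>q (i, a). if q < n \<and> i \<in> {1,2} \<and> a < k \<and> tb ! (q * (2 * k) + (i - 1) * k + a) < n
                  then Some (tb ! (q * (2 * k) + (i - 1) * k + a)) else None),
      set F)"

fun encode_code :: "dfa_code \<Rightarrow> nat" where
  "encode_code (n, q0, F, tb) = prod_encode (n, prod_encode (q0, prod_encode (list_encode F, list_encode tb)))"

definition encode_input :: "nat \<Rightarrow> dfa_code \<Rightarrow> dfa_code \<Rightarrow> nat" where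
  "encode_input k cS cT = prod_encode (k, prod_encode (encode_code cS, encode_code cT))"

datatype recf = Z | S | Proj nat | Comp recf "recf list" | Prim recf recf | Mn recf

inductive eval :: "recf \<Rightarrow> nat list \<Rightarrow> nat \<Rightarrow> bool" where
  eval_Z: "eval Z xs 0"
| eval_S: "eval S (x # xs) (Suc x)"
| eval_Proj: "i < length xs \<Longrightarrow> eval (Proj i) xs (xs ! i)"
| eval_Comp: "list_all2 (\<lambda>g y. eval g xs y) gs ys \<Longrightarrow> eval f ys z \<Longrightarrow> eval (Comp f gs) xs z"
| eval_Prim0: "eval f xs y \<Longrightarrow> eval (Prim f g) (0 # xs) y"
| eval_PrimS: "eval (Prim f g) (n # xs) y \<Longrightarrow> eval g (n # y # xs) z \<Longrightarrow> eval (Prim f g) (Suc n # xs) z"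
| eval_Mn: "eval f (n # xs) 0 \<Longrightarrow> (\<forall>m<n. \<exists>y. eval f (m # xs) (Suc y)) \<Longrightarrow> eval (Mn f) xs n"

end

theory Submission
  imports Defs "HOL-Library.Sublist"
begin

text \<open>
  A language of finite shift denotes a recognizable relation. If three shifts of an accepting run of
  the \<open>n\<close>-state automaton of \<open>S\<close> occurred at the same state, then the loop between the outer two
  would contain a shift, and pumping it would make the number of shifts unbounded; hence every word
  of \<open>S\<close> has at most \<open>2n\<close> shifts and splits into a fixed number of possibly empty blocks of
  alternating direction. Membership of \<open>sem w\<close> in \<open>sem_set S\<close> is therefore witnessed by a tuple of
  cut states between the blocks, and for a fixed tuple the input and the output projection of \<open>w\<close> are
  parsed independently of each other, by a finite automaton.

  So the set of all \<open>w \<in> T\<close> with \<open>sem w \<in> sem_set S\<close> and the domain of \<open>sem_set S\<close> are regular, and a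
  sequential uniformizer is a strategy in a finite safety game: after each input letter the output
  player writes a finite word and, if the input read so far lies in the domain, passes a position
  where the word read so far is in that set. A uniformizer exists iff some set of positions
  containing the initial one is closed under this requirement. All objects of the game are coded by
  numbers below computable bounds, so this condition is a formula with bounded quantifiers only,
  which is decided by a recursive function.
\<close>

section \<open>Recursive functions and bounded quantifiers\<close>

text \<open>Environments are functions so that a binder can bind variable \<open>0\<close> and shift the others by
  \<open>Suc\<close>, which is the form in which unification with the rules below presents the premises.\<close>

definition computable :: "nat \<Rightarrow> ((nat \<Rightarrow> nat) \<Rightarrow> nat) \<Rightarrow> bool" where
  "computable m g \<longleftrightarrow> (\<exists>f. \<forall>e. eval f (map e [0..<m]) (g e))"

abbreviation decidable :: "nat \<Rightarrow> ((nat \<Rightarrow> nat) \<Rightarrow> bool) \<Rightarrow> bool" where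
  "decidable m P \<equiv> computable m (\<lambda>e. of_bool (P e))"

named_theorems computable_intros

lemma computable_comp:
  assumes "computable n G" and "\<And>i. i < n \<Longrightarrow> computable m (gs i)"
  shows "computable m (\<lambda>e. G (\<lambda>i. gs i e))"
proof -
  obtain f where f: "\<And>e. eval f (map e [0..<n]) (G e)"
    using assms(1) by (auto simp: computable_def)
  have "\<forall>i. \<exists>h. i < n \<longrightarrow> (\<forall>e. eval h (map e [0..<m]) (gs i e))"
    using assms(2) by (auto simp: computable_def)
  then obtain h where h: "\<And>i e. i < n \<Longrightarrow> eval (h i) (map e [0..<m]) (gs i e)"
    by metis
  have "eval (Comp f (map h [0..<n])) (map e [0..<m]) (G (\<lambda>i. gs i e))" for e
  proof (rule eval_Comp)
    show "list_all2 (\<lambda>g y. eval g (map e [0..<m]) y) (map h [0..<n]) (map (\<lambda>i. gs i e) [0..<n])"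
      using h by (simp add: list_all2_conv_all_nth)
  qed (rule f)
  then show ?thesis
    unfolding computable_def by blast
qed

lemma computable_comp_list:
  assumes "computable (length gs) G" and "list_all (computable m) gs"
  shows "computable m (\<lambda>e. G (\<lambda>i. (gs ! i) e))"
  by (rule computable_comp[OF assms(1), of m "(!) gs"])
    (use assms(2) in \<open>auto simp: list_all_length\<close>)

lemma computable_comp1:
  assumes "computable 1 (\<lambda>e. G (e 0))" "computable m f"
  shows "computable m (\<lambda>e. G (f e))"
  using computable_comp[OF assms(1), of m "\<lambda>i. f"] assms(2) by simp

lemma computable_comp2:
  assumes "computable 2 (\<lambda>e. G (e 0) (e 1))" "computable m f0" "computable m f1"
  shows "computable m (\<lambda>e. G (f0 e) (f1 e))"
  using computable_comp_list[of "[f0, f1]" "\<lambda>e. G (e 0) (e 1)" m] assms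
  by (simp add: numeral_eq_Suc)

lemma computable_comp3:
  assumes "computable 3 (\<lambda>e. G (e 0) (e 1) (e 2))"
    "computable m f0" "computable m f1" "computable m f2"
  shows "computable m (\<lambda>e. G (f0 e) (f1 e) (f2 e))"
  using computable_comp_list[of "[f0, f1, f2]" "\<lambda>e. G (e 0) (e 1) (e 2)" m] assms
  by (simp add: numeral_eq_Suc)

lemma computable_comp4:
  assumes "computable 4 (\<lambda>e. G (e 0) (e 1) (e 2) (e 3))"
    "computable m f0" "computable m f1" "computable m f2" "computable m f3"
  shows "computable m (\<lambda>e. G (f0 e) (f1 e) (f2 e) (f3 e))"
  using computable_comp_list[of "[f0, f1, f2, f3]" "\<lambda>e. G (e 0) (e 1) (e 2) (e 3)" m] assms
  by (simp add: numeral_eq_Suc)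

lemma computable_comp5:
  assumes "computable 5 (\<lambda>e. G (e 0) (e 1) (e 2) (e 3) (e 4))"
    "computable m f0" "computable m f1" "computable m f2" "computable m f3" "computable m f4"
  shows "computable m (\<lambda>e. G (f0 e) (f1 e) (f2 e) (f3 e) (f4 e))"
  using computable_comp_list[of "[f0, f1, f2, f3, f4]" "\<lambda>e. G (e 0) (e 1) (e 2) (e 3) (e 4)" m]
    assms
  by (simp add: numeral_eq_Suc)

lemma computable_var [computable_intros]:
  assumes "i < m" shows "computable m (\<lambda>e. e i)"
proof -
  have "eval (Proj i) (map e [0..<m]) (e i)" for e
    using eval_Proj[of i "map e [0..<m]"] assms by simp
  then show ?thesis
    unfolding computable_def by blast
qed

lemma computable_Suc [computable_intros]:
  assumes "computable m f" shows "computable m (\<lambda>e. Suc (f e))"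
proof -
  have "computable 1 (\<lambda>e. Suc (e 0))"
    unfolding computable_def by (rule exI[of _ recf.S]) (simp add: eval_S)
  from computable_comp1[of Suc, OF this assms] show ?thesis .
qed

lemma computable_const [computable_intros]: "computable m (\<lambda>e. c)"
proof (induction c)
  case 0
  show ?case
    unfolding computable_def by (rule exI[of _ Z]) (simp add: eval_Z)
qed (rule computable_Suc)

lemma computable_rec_nat:
  assumes f: "computable m f"
    and g: "computable (Suc (Suc m)) (\<lambda>e. g (e 0) (e (Suc 0)) (\<lambda>i. e (Suc (Suc i))))"
    and h: "computable m h"
  shows "computable m (\<lambda>e. rec_nat (f e) (\<lambda>n y. g n y e) (h e))"
proof -
  obtain F where F: "\<And>e. eval F (map e [0..<m]) (f e)"
    using f by (auto simp: computable_def)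
  obtain G where "\<And>e. eval G (map e [0..<Suc (Suc m)]) (g (e 0) (e (Suc 0)) (\<lambda>i. e (Suc (Suc i))))"
    using g by (auto simp: computable_def)
  from this[of "case_nat _ (case_nat _ _)"]
  have G: "eval G (n # y # map e [0..<m]) (g n y e)" for n y e
    by (simp add: map_upt_Suc del: upt_Suc)
  have "eval (Prim F G) (n # map e [0..<m]) (rec_nat (f e) (\<lambda>n y. g n y e) n)" for n e
    by (induction n) (auto intro: eval_Prim0 eval_PrimS F G)
  then have "eval (Prim F G) (map e [0..<Suc m])
      (rec_nat (f (\<lambda>i. e (Suc i))) (\<lambda>n y. g n y (\<lambda>i. e (Suc i))) (e 0))" for e
    by (simp add: map_upt_Suc del: upt_Suc)
  then have rec: "computable (Suc m)
      (\<lambda>e. rec_nat (f (\<lambda>i. e (Suc i))) (\<lambda>n y. g n y (\<lambda>i. e (Suc i))) (e 0))"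
    unfolding computable_def by blast
  have "computable m (case_nat h (\<lambda>i e. e i) i)" if "i < Suc m" for i
    using that h by (cases i) (auto intro: computable_var)
  from computable_comp[OF rec, of m "case_nat h (\<lambda>i e. e i)", OF this] show ?thesis
    by simp
qed

lemma computable_add [computable_intros]:
  assumes "computable m f" "computable m g" shows "computable m (\<lambda>e. f e + g e)"
proof -
  have "computable m (\<lambda>e. rec_nat (g e) (\<lambda>n y. Suc y) (f e))"
    by (intro computable_rec_nat assms computable_intros) simp_all
  moreover have "rec_nat y (\<lambda>n y. Suc y) x = x + y" for x y :: nat
    by (induction x) auto
  ultimately show ?thesis by simp
qed

lemma computable_mult [computable_intros]:
  assumes "computable m f" "computable m g" shows "computable m (\<lambda>e. f e * g e)"
proof -
  have "computable 2 (\<lambda>e. rec_nat 0 (\<lambda>n y. y + e 1) (e 0))"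
    by (intro computable_rec_nat[where g = "\<lambda>n y e. y + e 1"] computable_intros) simp_all
  moreover have "rec_nat 0 (\<lambda>n z. z + y) x = x * y" for x y :: nat
    by (induction x) auto
  ultimately have "computable 2 (\<lambda>e. e 0 * e 1)" by simp
  from computable_comp2[of "(*)", OF this assms] show ?thesis .
qed

lemma computable_power [computable_intros]:
  assumes "computable m f" "computable m g" shows "computable m (\<lambda>e. f e ^ g e)"
proof -
  have "computable 2 (\<lambda>e. rec_nat 1 (\<lambda>n y. e 0 * y) (e 1))"
    by (intro computable_rec_nat[where g = "\<lambda>n y e. e 0 * y"] computable_intros) simp_all
  moreover have "rec_nat (Suc 0) (\<lambda>n z. x * z) y = x ^ y" for x y :: nat
    by (induction y) auto
  ultimately have "computable 2 (\<lambda>e. e 0 ^ e 1)" by simp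
  from computable_comp2[of "(^)", OF this assms] show ?thesis .
qed

lemma computable_diff [computable_intros]:
  assumes "computable m f" "computable m g" shows "computable m (\<lambda>e. f e - g e)"
proof -
  have "computable 1 (\<lambda>e. rec_nat 0 (\<lambda>n y. n) (e 0))"
    by (intro computable_rec_nat[where g = "\<lambda>n y e. n"] computable_intros) simp_all
  moreover have "rec_nat 0 (\<lambda>n y. n) x = x - 1" for x :: nat
    by (cases x) auto
  ultimately have pred: "computable 1 (\<lambda>e. e 0 - 1)" by simp
  have "computable 2 (\<lambda>e. rec_nat (e 0) (\<lambda>n y. y - 1) (e 1))"
    by (intro computable_rec_nat[where g = "\<lambda>n y e. y - 1"] computable_intros
        computable_comp1[of "\<lambda>x. x - 1", OF pred]) simp_all
  moreover have "rec_nat x (\<lambda>n y. y - 1) y = x - y" for x y :: nat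
    by (induction y) auto
  ultimately have "computable 2 (\<lambda>e. e 0 - e 1)" by simp
  from computable_comp2[of "(-)", OF this assms] show ?thesis .
qed

lemma decidable_not [computable_intros]:
  assumes "decidable m P" shows "decidable m (\<lambda>e. \<not> P e)"
proof -
  have "computable m (\<lambda>e. 1 - of_bool (P e))"
    by (intro computable_intros assms)
  moreover have "1 - of_bool (P e) = (of_bool (\<not> P e) :: nat)" for e by simp
  ultimately show ?thesis by simp
qed

lemma decidable_conj [computable_intros]:
  assumes "decidable m P" "decidable m Q" shows "decidable m (\<lambda>e. P e \<and> Q e)"
  unfolding of_bool_conj by (intro computable_intros assms)

lemma decidable_disj [computable_intros]:
  assumes "decidable m P" "decidable m Q" shows "decidable m (\<lambda>e. P e \<or> Q e)"
  using decidable_not[OF decidable_conj[OF assms[THEN decidable_not]]] by simp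

lemma decidable_imp [computable_intros]:
  assumes "decidable m P" "decidable m Q" shows "decidable m (\<lambda>e. P e \<longrightarrow> Q e)"
  unfolding imp_conv_disj by (intro computable_intros assms)

lemma decidable_less [computable_intros]:
  assumes "computable m f" "computable m g" shows "decidable m (\<lambda>e. f e < g e)"
proof -
  have "computable m (\<lambda>e. 1 - (1 - (g e - f e)))"
    by (intro computable_intros assms)
  moreover have "1 - (1 - (g e - f e)) = of_bool (f e < g e)" for e by simp
  ultimately show ?thesis by simp
qed

lemma decidable_le [computable_intros]:
  assumes "computable m f" "computable m g" shows "decidable m (\<lambda>e. f e \<le> g e)"
  unfolding not_less[symmetric] by (intro computable_intros assms)

lemma decidable_eq [computable_intros]:
  assumes "computable m f" "computable m g" shows "decidable m (\<lambda>e. f e = g e)"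
  unfolding eq_iff by (intro computable_intros assms)

text \<open>The bounded sum is the only binder that needs recursion; all others reduce to it.\<close>

lemma computable_sum [computable_intros]:
  assumes b: "computable m b" and f: "computable (Suc m) (\<lambda>e. f (e 0) (\<lambda>i. e (Suc i)))"
  shows "computable m (\<lambda>e. \<Sum>y<b e. f y e)"
proof -
  let ?drop1 = "case_nat (\<lambda>e. e 0) (\<lambda>i e. e (Suc (Suc i)))"
  have "computable (Suc (Suc m)) (?drop1 i)" if "i < Suc m" for i
    using that by (cases i) (auto intro!: computable_intros)
  from computable_comp[OF f, of "Suc (Suc m)" ?drop1, OF this]
  have "computable (Suc (Suc m)) (\<lambda>e. f (e 0) (\<lambda>i. e (Suc (Suc i))))"
    by simp
  then have "computable m (\<lambda>e. rec_nat 0 (\<lambda>n y. y + f n e) (b e))"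
    by (intro computable_rec_nat[where g = "\<lambda>n y e. y + f n e"] computable_intros b) simp_all
  moreover have "rec_nat 0 (\<lambda>n y. y + f n e) x = (\<Sum>y<x. f y e)" for e x
    by (induction x) auto
  ultimately show ?thesis by simp
qed

lemma decidable_ex [computable_intros]:
  assumes "computable m b" "decidable (Suc m) (\<lambda>e. P (e 0) (\<lambda>i. e (Suc i)))"
  shows "decidable m (\<lambda>e. \<exists>y<b e. P y e)"
proof -
  have "decidable m (\<lambda>e. 0 < (\<Sum>y<b e. of_bool (P y e) :: nat))"
    by (intro computable_intros assms)
  moreover have "0 < (\<Sum>y<b e. of_bool (P y e) :: nat) \<longleftrightarrow> (\<exists>y<b e. P y e)" for e
    by (auto simp: card_gt_0_iff)
  ultimately show ?thesis by simp
qed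

lemma decidable_all [computable_intros]:
  assumes "computable m b" "decidable (Suc m) (\<lambda>e. P (e 0) (\<lambda>i. e (Suc i)))"
  shows "decidable m (\<lambda>e. \<forall>y<b e. P y e)"
  using decidable_not[OF decidable_ex[OF assms(1) decidable_not[OF assms(2)]]] by simp

lemma computable_if_decidable_graph:
  assumes "computable m b" "\<And>e. f e \<le> b e" "decidable (Suc m) (\<lambda>e. e 0 = f (\<lambda>i. e (Suc i)))"
  shows "computable m f"
proof -
  have "computable m (\<lambda>e. \<Sum>y<Suc (b e). y * of_bool (y = f e))"
    by (intro computable_intros assms) simp
  moreover have "(\<Sum>y<Suc (b e). y * of_bool (y = f e)) = f e" for e
    using assms(2)[of e] by (simp add: le_imp_less_Suc del: sum.lessThan_Suc)
  ultimately show ?thesis by simp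
qed

lemma computable_div [computable_intros]:
  assumes "computable m f" "computable m g" shows "computable m (\<lambda>e. f e div g e)"
proof -
  have graph: "z = x div y \<longleftrightarrow> y = 0 \<and> z = 0 \<or> z * y \<le> x \<and> x < Suc z * y" for x y z :: nat
    using div_nat_eqI[of y z x] dividend_less_div_times[of y x]
    by (cases "y = 0") (auto simp: mult.commute)
  have "computable 2 (\<lambda>e. e 0 div e 1)"
  proof (rule computable_if_decidable_graph)
    show "decidable (Suc 2) (\<lambda>e. e 0 = e (Suc 0) div e (Suc 1))"
      unfolding graph by (intro computable_intros) simp_all
    show "computable 2 (\<lambda>e. e 0)" by (intro computable_intros) simp
  qed simp
  from computable_comp2[of "(div)", OF this assms] show ?thesis .
qed

lemma computable_mod [computable_intros]:
  assumes "computable m f" "computable m g" shows "computable m (\<lambda>e. f e mod g e)"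
  unfolding modulo_nat_def by (intro computable_intros assms)

section \<open>Pairs, lists and finite sets as numbers\<close>

lemma computable_prod_encode [computable_intros]:
  assumes "computable m f" "computable m g" shows "computable m (\<lambda>e. prod_encode (f e, g e))"
  unfolding prod_encode_def triangle_def prod.case by (intro computable_intros assms)

abbreviation fst_decode :: "nat \<Rightarrow> nat" where "fst_decode c \<equiv> fst (prod_decode c)"
abbreviation snd_decode :: "nat \<Rightarrow> nat" where "snd_decode c \<equiv> snd (prod_decode c)"

lemma fst_decode_le: "fst_decode c \<le> c" and snd_decode_le: "snd_decode c \<le> c"
  using le_prod_encode_1[of "fst_decode c" "snd_decode c"]
    le_prod_encode_2[of "snd_decode c" "fst_decode c"] by simp_all

lemma computable_fst_decode [computable_intros]:
  assumes "computable m f" shows "computable m (\<lambda>e. fst_decode (f e))"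
proof -
  have graph: "x = fst_decode c \<longleftrightarrow> (\<exists>y<Suc c. prod_encode (x, y) = c)" for x c
    by (auto intro!: exI[of _ "snd_decode c"] simp: snd_decode_le less_Suc_eq_le)
  have "computable 1 (\<lambda>e. fst_decode (e 0))"
  proof (rule computable_if_decidable_graph)
    show "decidable (Suc 1) (\<lambda>e. e 0 = fst_decode (e (Suc 0)))"
      unfolding graph by (intro computable_intros) simp_all
    show "computable 1 (\<lambda>e. e 0)" by (intro computable_intros) simp
  qed (rule fst_decode_le)
  from computable_comp1[of fst_decode, OF this assms] show ?thesis .
qed

lemma computable_snd_decode [computable_intros]:
  assumes "computable m f" shows "computable m (\<lambda>e. snd_decode (f e))"
proof -
  have graph: "y = snd_decode c \<longleftrightarrow> prod_encode (fst_decode c, y) = c" for y c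
    by (metis prod.collapse prod_decode_inverse prod_encode_inverse snd_conv)
  have "computable 1 (\<lambda>e. snd_decode (e 0))"
  proof (rule computable_if_decidable_graph)
    show "decidable (Suc 1) (\<lambda>e. e 0 = snd_decode (e (Suc 0)))"
      unfolding graph by (intro computable_intros) simp_all
    show "computable 1 (\<lambda>e. e 0)" by (intro computable_intros) simp
  qed (rule snd_decode_le)
  from computable_comp1[of snd_decode, OF this assms] show ?thesis .
qed

lemma prod_encode_mono: "a \<le> a' \<Longrightarrow> b \<le> b' \<Longrightarrow> prod_encode (a, b) \<le> prod_encode (a', b')"
  unfolding prod_encode_def triangle_def prod.case by (intro add_mono div_le_mono mult_le_mono) auto

lemma prod_encode_strict_mono: "a < a' \<Longrightarrow> b \<le> b' \<Longrightarrow> prod_encode (a, b) < prod_encode (a', b')"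
  using prod_encode_mono[of a a' b b'] by (simp add: less_le)

definition code_drop :: "nat \<Rightarrow> nat \<Rightarrow> nat" where
  "code_drop i c = rec_nat c (\<lambda>_ y. snd_decode (y - 1)) i"

definition code_nth :: "nat \<Rightarrow> nat \<Rightarrow> nat" where
  "code_nth i c = fst_decode (code_drop i c - 1)"

definition code_member :: "nat \<Rightarrow> nat \<Rightarrow> bool" where
  "code_member x c \<longleftrightarrow> (\<exists>i<c. 0 < code_drop i c \<and> code_nth i c = x)"

lemma code_drop_list_encode: "code_drop i (list_encode xs) = list_encode (drop i xs)"
proof (induction i)
  case (Suc i)
  have "prod_decode 0 = (0, 0)"
    using prod_encode_inverse[of "(0, 0)"] by (simp add: prod_encode_def)
  then have "snd_decode (list_encode ys - 1) = list_encode (tl ys)" for ys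
    by (cases ys) simp_all
  then show ?case
    using Suc by (simp add: code_drop_def drop_Suc tl_drop)
qed (simp add: code_drop_def)

lemma code_nth_list_encode: "i < length xs \<Longrightarrow> code_nth i (list_encode xs) = xs ! i"
  by (cases "drop i xs") (auto simp: code_nth_def code_drop_list_encode hd_drop_conv_nth[symmetric])

lemma list_encode_pos_iff: "0 < list_encode xs \<longleftrightarrow> xs \<noteq> []"
  by (cases xs) auto

lemma length_le_list_encode: "length xs \<le> list_encode xs"
  by (induction xs) (auto intro: order_trans[OF _ le_prod_encode_2])

lemma code_member_list_encode: "code_member x (list_encode xs) \<longleftrightarrow> x \<in> set xs"
proof -
  have "i < length xs \<Longrightarrow> i < list_encode xs" for i
    using length_le_list_encode[of xs] by simp
  then show ?thesis
    unfolding code_member_def code_drop_list_encode list_encode_pos_iff in_set_conv_nth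
    using code_nth_list_encode[of _ xs] by (metis drop_eq_Nil not_le)
qed

lemma computable_code_drop [computable_intros]:
  assumes "computable m f" "computable m g" shows "computable m (\<lambda>e. code_drop (f e) (g e))"
  unfolding code_drop_def
  by (intro computable_rec_nat[where g = "\<lambda>_ y _. snd_decode (y - 1)"] computable_intros assms) simp

lemma computable_code_nth [computable_intros]:
  assumes "computable m f" "computable m g" shows "computable m (\<lambda>e. code_nth (f e) (g e))"
  unfolding code_nth_def by (intro computable_intros assms)

lemma decidable_code_member [computable_intros]:
  assumes "computable m f" "computable m g" shows "decidable m (\<lambda>e. code_member (f e) (g e))"
proof -
  have "decidable 2 (\<lambda>e. code_member (e 0) (e 1))"
    unfolding code_member_def by (intro computable_intros) simp_all
  from computable_comp2[of "\<lambda>x c. of_bool (code_member x c)", OF this assms] show ?thesis .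
qed

lemma set_encode_less:
  assumes "A \<subseteq> {..<m}" shows "set_encode A < 2 ^ m"
proof -
  have "set_encode A \<le> (\<Sum>i<m. 2 ^ i)"
    unfolding set_encode_def using assms by (intro sum_mono2) auto
  also have "\<dots> < (2 ^ m :: nat)" by (induction m) auto
  finally show ?thesis .
qed

lemma set_decode_subset:
  assumes "c < 2 ^ m" shows "set_decode c \<subseteq> {..<m}"
proof
  fix x assume "x \<in> set_decode c"
  then have "c div 2 ^ x \<noteq> 0"
    unfolding set_decode_def by (metis even_zero mem_Collect_eq)
  then have "(2 :: nat) ^ x < 2 ^ m"
    using assms by (metis div_less le_less_trans not_le)
  then show "x \<in> {..<m}" by simp
qed

lemma ex_subset_iff_ex_code: "(\<exists>X\<subseteq>{..<b}. P X) \<longleftrightarrow> (\<exists>c<2 ^ b. P (set_decode c))"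
proof
  assume "\<exists>X\<subseteq>{..<b}. P X"
  then obtain X where X: "X \<subseteq> {..<b}" "P X" by blast
  then have "set_decode (set_encode X) = X"
    by (metis finite_lessThan finite_subset set_encode_inverse)
  then show "\<exists>c<2 ^ b. P (set_decode c)"
    using X set_encode_less by metis
qed (use set_decode_subset in blast)

lemma decidable_set_decode [computable_intros]:
  assumes "computable m f" "computable m g" shows "decidable m (\<lambda>e. f e \<in> set_decode (g e))"
  unfolding set_decode_def mem_Collect_eq odd_iff_mod_2_eq_one by (intro computable_intros assms)

lemma decidable_ex_subset [computable_intros]:
  assumes "computable m b" "decidable (Suc m) (\<lambda>e. P (set_decode (e 0)) (\<lambda>i. e (Suc i)))"
  shows "decidable m (\<lambda>e. \<exists>X\<subseteq>{..<b e}. P X e)"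
  unfolding ex_subset_iff_ex_code by (intro computable_intros assms)

lemma computable_set_encode [computable_intros]:
  assumes "computable m b" "decidable (Suc m) (\<lambda>e. P (e 0) (\<lambda>i. e (Suc i)))"
  shows "computable m (\<lambda>e. set_encode {y \<in> {..<b e}. P y e})"
proof -
  have "set_encode {y \<in> {..<b e}. P y e} = (\<Sum>y<b e. of_bool (P y e) * 2 ^ y)" for e
    unfolding set_encode_def sum.inter_filter[OF finite_lessThan] by (intro sum.cong) auto
  moreover have "computable m (\<lambda>e. \<Sum>y<b e. of_bool (P y e) * 2 ^ y)"
    by (intro computable_intros assms) simp
  ultimately show ?thesis by simp
qed

lemma rtranclp_less_add_Suc:
  assumes "r\<^sup>*\<^sup>* x y" "\<And>x y. r x y \<Longrightarrow> y < b" shows "y < b + Suc x"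
  using assms by (cases rule: rtranclp.cases) force+

lemma rtranclp_iff_closed_subsets:
  assumes "x < b" and less: "\<And>u v. r u v \<Longrightarrow> v < b"
  shows "r\<^sup>*\<^sup>* x y \<longleftrightarrow>
    \<not> (\<exists>X\<subseteq>{..<b}. x \<in> X \<and> (\<forall>u<b. \<forall>v<b. u \<in> X \<and> r u v \<longrightarrow> v \<in> X) \<and> y \<notin> X)"
    (is "_ \<longleftrightarrow> \<not> ?separated")
proof
  assume xy: "r\<^sup>*\<^sup>* x y"
  show "\<not> ?separated"
  proof
    assume ?separated
    then obtain X where X: "x \<in> X" "\<And>u v. u < b \<Longrightarrow> v < b \<Longrightarrow> u \<in> X \<Longrightarrow> r u v \<Longrightarrow> v \<in> X"
      and "y \<notin> X" by blast
    from xy have "y < b \<and> y \<in> X"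
      by induction (use assms X in auto)
    with \<open>y \<notin> X\<close> show False by blast
  qed
next
  assume not_separated: "\<not> ?separated"
  let ?X = "{y. y < b \<and> r\<^sup>*\<^sup>* x y}"
  have "?X \<subseteq> {..<b} \<and> x \<in> ?X \<and> (\<forall>u<b. \<forall>v<b. u \<in> ?X \<and> r u v \<longrightarrow> v \<in> ?X)"
    using assms(1) by (auto intro: rtranclp.rtrancl_into_rtrancl)
  then have "y \<in> ?X" using not_separated by blast
  then show "r\<^sup>*\<^sup>* x y" by blast
qed

lemma decidable_rtranclp:
  assumes b: "computable 1 (\<lambda>e. b (e 0))" and r: "decidable 3 (\<lambda>e. r (e 0) (e 1) (e 2))"
    and less: "\<And>v x y. r v x y \<Longrightarrow> y < b v"
    and args: "computable m p" "computable m f" "computable m g"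
  shows "decidable m (\<lambda>e. (r (p e))\<^sup>*\<^sup>* (f e) (g e))"
proof -
  note rules = computable_intros computable_comp1[of b, OF b]
    computable_comp3[of "\<lambda>v x y. of_bool (r v x y)", OF r]
  have less_Suc: "r v u w \<Longrightarrow> w < b v + Suc x" for v u w x
    using less[of v u w] by simp
  have "(r v)\<^sup>*\<^sup>* x y \<longleftrightarrow> \<not> (\<exists>X\<subseteq>{..<b v + Suc x}. x \<in> X \<and>
      (\<forall>u<b v + Suc x. \<forall>w<b v + Suc x. u \<in> X \<and> r v u w \<longrightarrow> w \<in> X) \<and> y \<notin> X)" for v x y
    by (rule rtranclp_iff_closed_subsets) (simp, rule less_Suc)
  moreover have "decidable 3 (\<lambda>e. \<not> (\<exists>X\<subseteq>{..<b (e 0) + Suc (e 1)}. e 1 \<in> X \<and>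
      (\<forall>u<b (e 0) + Suc (e 1). \<forall>w<b (e 0) + Suc (e 1). u \<in> X \<and> r (e 0) u w \<longrightarrow> w \<in> X) \<and> e 2 \<notin> X))"
    by (intro rules) simp_all
  ultimately have "decidable 3 (\<lambda>e. (r (e 0))\<^sup>*\<^sup>* (e 1) (e 2))"
    by simp
  from computable_comp3[of "\<lambda>v x y. of_bool ((r v)\<^sup>*\<^sup>* x y)", OF this args] show ?thesis .
qed

section \<open>Words, projections and runs\<close>

lemma steps_Cons_eq_Some_iff:
  "steps \<delta> q (x # w) = Some r \<longleftrightarrow> (\<exists>p. \<delta> q x = Some p \<and> steps \<delta> p w = Some r)"
  by (auto split: option.splits)

lemma steps_append_eq_Some_iff:
  "steps \<delta> q (u @ v) = Some r \<longleftrightarrow> (\<exists>p. steps \<delta> q u = Some p \<and> steps \<delta> p v = Some r)"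
  by (induction u arbitrary: q) (auto split: option.splits)

lemma steps_snoc_eq_Some_iff:
  "steps \<delta> q (w @ [x]) = Some r \<longleftrightarrow> (\<exists>p. steps \<delta> q w = Some p \<and> \<delta> p x = Some r)"
  by (auto simp: steps_append_eq_Some_iff split: option.splits)

lemma dfa_wf_delta:
  assumes "dfa_wf k A" "delta A q x = Some p"
  shows "q \<in> states A" "x \<in> Sigma_io k" "p \<in> states A"
  using assms unfolding dfa_wf_def by blast+

lemma dfa_wf_steps_letters:
  assumes "dfa_wf k A" "steps (delta A) q w = Some p" shows "w \<in> lists (Sigma_io k)"
  using assms(2)
  by (induction w arbitrary: q)
    (auto simp: steps_Cons_eq_Some_iff dfa_wf_delta(2)[OF assms(1)] simp del: steps.simps(2))

lemma dfa_wf_steps_states: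
  assumes "dfa_wf k A" "steps (delta A) q w = Some p" "q \<in> states A" shows "p \<in> states A"
  using assms(2,3)
  by (induction w arbitrary: q)
    (auto simp: steps_Cons_eq_Some_iff dest: dfa_wf_delta(3)[OF assms(1)] simp del: steps.simps(2))

definition runs :: "dfa \<Rightarrow> letter list set" where
  "runs A = {w. \<exists>q. steps (delta A) (init A) w = Some q}"

lemma lang_subset_runs: "lang A \<subseteq> runs A"
  by (auto simp: lang_def runs_def)

lemma runs_prefix: "u @ v \<in> runs A \<Longrightarrow> u \<in> runs A"
  by (auto simp: runs_def steps_append_eq_Some_iff)

lemma runs_letters: "dfa_wf k A \<Longrightarrow> w \<in> runs A \<Longrightarrow> w \<in> lists (Sigma_io k)"
  using dfa_wf_steps_letters unfolding runs_def by blast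

lemma proj_i_simps [simp]:
  "proj_i [] = []" "proj_i (x # w) = (if fst x = 1 then snd x # proj_i w else proj_i w)"
  "proj_i (u @ v) = proj_i u @ proj_i v"
  by (simp_all add: proj_i_def)

abbreviation inputs :: "nat list \<Rightarrow> letter list" where "inputs \<equiv> map (Pair 1)"
abbreviation outputs :: "nat list \<Rightarrow> letter list" where "outputs \<equiv> map (Pair 2)"

lemma proj_i_map_Pair [simp]: "proj_i (map (Pair d) u) = (if d = 1 then u else [])"
  by (simp add: proj_i_def comp_def)

lemma set_proj_i: "w \<in> lists (Sigma_io k) \<Longrightarrow> set (proj_i w) \<subseteq> {..<k}"
  by (induction w) (auto simp: Sigma_io_def)

lemma inputs_in_lists_Sigma_io: "set u \<subseteq> {..<k} \<Longrightarrow> inputs u \<in> lists (Sigma_io k)"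
  and outputs_in_lists_Sigma_io: "set y \<subseteq> {..<k} \<Longrightarrow> outputs y \<in> lists (Sigma_io k)"
  by (auto simp: Sigma_io_def)

lemma proj_i_eq_Nil_iff:
  assumes "w \<in> lists (Sigma_io k)"
  shows "proj_i w = [] \<longleftrightarrow> (\<exists>y. w = outputs y \<and> set y \<subseteq> {..<k})"
proof
  assume "proj_i w = []"
  then have "w = outputs (map snd w) \<and> set (map snd w) \<subseteq> {..<k}"
    using assms by (induction w) (auto simp: Sigma_io_def split: if_splits)
  then show "\<exists>y. w = outputs y \<and> set y \<subseteq> {..<k}" by blast
qed auto

lemma proj_i_eq_Cons_iff:
  "proj_i w = a # u \<longleftrightarrow> (\<exists>y v. w = y @ (1, a) # v \<and> proj_i y = [] \<and> proj_i v = u)"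
  by (auto simp: proj_i_def Cons_eq_map_conv filter_eq_Cons_iff filter_empty_conv) blast+

lemma proj_i_eq_snoc_iff:
  "proj_i w = u @ [a] \<longleftrightarrow> (\<exists>v y. w = v @ (1, a) # y \<and> proj_i v = u \<and> proj_i y = [])"
proof
  have proj_i_rev: "proj_i (rev w) = rev (proj_i w)" for w
    by (simp add: proj_i_def rev_map rev_filter)
  assume "proj_i w = u @ [a]"
  then have "proj_i (rev w) = a # rev u" by (simp add: proj_i_rev)
  then obtain y v where "rev w = y @ (1, a) # v" "proj_i y = []" "proj_i v = rev u"
    unfolding proj_i_eq_Cons_iff by blast
  then have "w = rev v @ (1, a) # rev y" "proj_i (rev v) = u" "proj_i (rev y) = []"
    by (simp_all add: rev_swap proj_i_rev)
  then show "\<exists>v y. w = v @ (1, a) # y \<and> proj_i v = u \<and> proj_i y = []" by blast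
qed auto

lemma Domain_sem_set: "Domain (sem_set L) = proj_i ` L"
  by (force simp: sem_set_def sem_def)

abbreviation only :: "nat \<Rightarrow> letter list \<Rightarrow> letter list" where
  "only d \<equiv> filter (\<lambda>x. fst x = d)"

lemma sem_eq_iff: "sem z = sem w \<longleftrightarrow> only 1 z = only 1 w \<and> only 2 z = only 2 w"
proof -
  have "map snd (only d z) = map snd (only d w) \<longleftrightarrow> only d z = only d w" for d
  proof -
    have "only d v = map (Pair d) (map snd (only d v))" for v
      by (induction v) auto
    then show ?thesis by metis
  qed
  then show ?thesis
    by (simp add: sem_def proj_i_def proj_o_def)
qed

section \<open>Sequential automata\<close>

lemma sequential_transition_unique:
  assumes "dfa_wf k A" "sequential A" "delta A q x = Some r" "delta A q x' = Some r'"
    and inputs: "fst x = 1 \<Longrightarrow> fst x' = 1 \<Longrightarrow> x = x'"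
  shows "x = x'"
proof -
  obtain Qi Qo where Q: "Qi \<union> Qo = states A" "\<forall>q\<in>Qi. \<forall>x. delta A q x \<noteq> None \<longrightarrow> fst x = 1"
     "\<forall>q\<in>Qo. \<forall>x y. delta A q x \<noteq> None \<and> delta A q y \<noteq> None \<longrightarrow> x = y"
    using assms(2) unfolding sequential_def by (elim exE conjE) (rule that)
  have "q \<in> states A"
    using dfa_wf_delta(1)[OF assms(1,3)] .
  then consider (reading) "q \<in> Qi" | (writing) "q \<in> Qo" using Q(1) by blast
  then show ?thesis
  proof cases
    case reading
    then show ?thesis using Q(2) assms(3,4) inputs by (metis option.distinct(1))
  next
    case writing
    then show ?thesis using Q(3) assms(3,4) by (metis option.distinct(1))
  qed
qed

lemma sequential_runs_comparable:
  assumes A: "dfa_wf k A" "sequential A" and "w \<in> runs A" "w' \<in> runs A"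
    and "prefix (proj_i w) (proj_i w')"
  shows "prefix w w' \<or> prefix w' w"
proof -
  have "prefix w w' \<or> prefix w' w"
    if "steps (delta A) q w = Some r" "steps (delta A) q w' = Some r'"
      "prefix (proj_i w) (proj_i w')" for q r r'
    using that
  proof (induction w arbitrary: q w')
    case (Cons x w)
    show ?case
    proof (cases w')
      case w': (Cons x' v)
      obtain p p' where p: "delta A q x = Some p" "delta A q x' = Some p'"
        "steps (delta A) p w = Some r" "steps (delta A) p' v = Some r'"
        using Cons.prems(1,2) unfolding w' steps_Cons_eq_Some_iff by blast
      have "x = x'"
      proof (rule sequential_transition_unique[OF A p(1,2)])
        show "x = x'" if "fst x = 1" "fst x' = 1"
          using that Cons.prems(3) w' by (simp add: prod_eq_iff)
      qed
      have "steps (delta A) p v = Some r'" "prefix (proj_i w) (proj_i v)"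
        using p Cons.prems(3) w' \<open>x = x'\<close> by (auto split: if_splits)
      then show ?thesis
        using Cons.IH[OF p(3)] w' \<open>x = x'\<close> by simp
    qed simp
  qed simp
  then show ?thesis
    using assms(3-) unfolding runs_def by blast
qed

lemma sequential_run_prefix:
  assumes "dfa_wf k A" "sequential A" "w \<in> runs A" "w' \<in> runs A" "prefix (proj_i w) (proj_i w')"
    and "w = [] \<or> fst (last w) = 1"
  shows "prefix w w'"
  using sequential_runs_comparable[OF assms(1-5)]
proof
  assume "prefix w' w"
  then obtain z where z: "w = w' @ z" by (auto elim: prefixE)
  then have "proj_i z = []" using assms(5) by (auto simp: prefix_def)
  then have "z = []" using assms(6) z by (cases z rule: rev_cases) auto
  then show ?thesis using z by simp
qed

lemma sequential_output_before_input:
  assumes "dfa_wf k A" "sequential A" "w @ outputs y \<in> runs A" "w @ outputs z @ [(1, a)] \<in> runs A"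
  shows "prefix y z"
proof -
  have "\<not> prefix (w @ outputs z @ [(1, a)]) (w @ outputs y)"
    by (auto simp: prefix_def map_eq_append_conv)
  then have "prefix (w @ outputs y) (w @ outputs z @ [(1, a)])"
    using sequential_runs_comparable[OF assms(1,2,3,4)] by simp
  then have "prefix (outputs y) (outputs z)"
    by (cases y rule: rev_cases) (auto simp: prefix_snoc)
  then show ?thesis
    using map_mono_prefix[of "outputs y" "outputs z" snd] by (simp add: comp_def)
qed

section \<open>Languages of finite shift have boundedly many shifts\<close>

definition shifts :: "letter list \<Rightarrow> nat set" where
  "shifts w = {j. Suc j < length w \<and> fst (w ! j) \<noteq> fst (w ! Suc j)}"

lemma finite_shifts: "finite (shifts w)"
  by (rule finite_subset[of _ "{..<length w}"]) (auto simp: shifts_def)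

lemma shift_eq_card_shifts: "shift w = card (shifts w)"
  by (simp add: shift_def shifts_def)

lemma shift_Nil [simp]: "shift [] = 0" and shift_single [simp]: "shift [x] = 0"
  by (simp_all add: shift_def)

lemma shift_Cons_Cons: "shift (x # y # w) = of_bool (fst x \<noteq> fst y) + shift (y # w)"
proof -
  have "j \<in> shifts (x # y # w) \<longleftrightarrow> j \<in> {j. j = 0 \<and> fst x \<noteq> fst y} \<union> Suc ` shifts (y # w)" for j
    by (cases j) (auto simp: shifts_def)
  then have "shifts (x # y # w) = {j. j = 0 \<and> fst x \<noteq> fst y} \<union> Suc ` shifts (y # w)"
    by blast
  moreover have "card ({j :: nat. j = 0 \<and> fst x \<noteq> fst y} \<union> Suc ` shifts (y # w)) =
      of_bool (fst x \<noteq> fst y) + card (shifts (y # w))"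
    by (subst card_Un_disjoint) (auto simp: finite_shifts card_image)
  ultimately show ?thesis
    by (simp add: shift_eq_card_shifts)
qed

lemma shift_append:
  assumes "u \<noteq> []" "v \<noteq> []"
  shows "shift (u @ v) = shift u + of_bool (fst (last u) \<noteq> fst (hd v)) + shift v"
  using assms(1)
proof (induction u rule: list_nonempty_induct)
  case (single x)
  then show ?case using assms(2) by (cases v) (auto simp: shift_Cons_Cons)
next
  case (cons x u)
  then show ?case by (cases u) (auto simp: shift_Cons_Cons)
qed

lemma shift_append_ge: "shift u + shift v \<le> shift (u @ v)"
  by (cases "u = []"; cases "v = []") (simp_all add: shift_append)

lemma shift_concat_replicate_ge: "i * shift d \<le> shift (concat (replicate i d))"
proof (induction i)
  case (Suc i)
  then show ?case using shift_append_ge[of d "concat (replicate i d)"] by simp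
qed simp

lemma shift_eq_0_if_loop:
  assumes "finite_shift (lang A)" and u: "steps (delta A) (init A) u = Some q"
    and d: "steps (delta A) q d = Some q" and v: "steps (delta A) q v = Some f" "f \<in> finals A"
  shows "shift d = 0"
proof -
  obtain N where N: "\<And>w. w \<in> lang A \<Longrightarrow> shift w \<le> N"
    using assms(1) by (auto simp: finite_shift_def)
  let ?pumped = "u @ concat (replicate (Suc N) d) @ v"
  have "steps (delta A) q (concat (replicate i d)) = Some q" for i
    by (induction i) (use d in \<open>auto simp: steps_append_eq_Some_iff\<close>)
  then have "?pumped \<in> lang A"
    using u v by (auto simp: lang_def steps_append_eq_Some_iff simp del: replicate.simps)
  then have "shift ?pumped \<le> N" by (rule N)
  moreover have "Suc N * shift d \<le> shift ?pumped"
    using shift_append_ge[of u "concat (replicate (Suc N) d) @ v"]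
      shift_append_ge[of "concat (replicate (Suc N) d)" v] shift_concat_replicate_ge[of "Suc N" d]
    by linarith
  ultimately have "Suc N * shift d \<le> N" by linarith
  then show ?thesis by (cases "shift d") auto
qed

lemma card_le_twice_card_image:
  fixes f :: "'a :: linorder \<Rightarrow> 'b"
  assumes "finite J"
    and outer_neq: "\<And>a b c. a \<in> J \<Longrightarrow> b \<in> J \<Longrightarrow> c \<in> J \<Longrightarrow> a < b \<Longrightarrow> b < c \<Longrightarrow> f a \<noteq> f c"
  shows "card J \<le> 2 * card (f ` J)"
proof -
  have fibre: "card {j \<in> J. f j = q} \<le> 2" if "q \<in> f ` J" for q
  proof -
    let ?C = "{j \<in> J. f j = q}"
    have C: "finite ?C" "?C \<noteq> {}"
      using assms(1) that by auto
    have "j \<in> {Min ?C, Max ?C}" if "j \<in> ?C" for j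
    proof (rule ccontr)
      assume "j \<notin> {Min ?C, Max ?C}"
      then have "Min ?C < j" "j < Max ?C"
        using Min_le[OF C(1) that] Max_ge[OF C(1) that] by auto
      then show False
        using outer_neq[of "Min ?C" j "Max ?C"] that Min_in[OF C] Max_in[OF C] by simp
    qed
    then have "card ?C \<le> card {Min ?C, Max ?C}"
      by (intro card_mono) auto
    then show ?thesis
      by (auto simp: card_insert_if split: if_splits)
  qed
  have "J = (\<Union>q\<in>f ` J. {j \<in> J. f j = q})" by auto
  then have "card J \<le> (\<Sum>q\<in>f ` J. card {j \<in> J. f j = q})"
    using card_UN_le[of "f ` J" "\<lambda>q. {j \<in> J. f j = q}"] assms(1) by simp
  also have "\<dots> \<le> (\<Sum>q\<in>f ` J. 2)" by (intro sum_mono fibre)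
  finally show ?thesis by simp
qed

text \<open>Of three shifts at the same state the middle one lies inside the loop between the outer two.\<close>

lemma shift_le_twice_card_states:
  assumes A: "dfa_wf k A" "finite_shift (lang A)" and z: "z \<in> lang A"
  shows "shift z \<le> 2 * card (states A)"
proof -
  let ?steps = "steps (delta A)"
  define state where "state j = the (?steps (init A) (take (Suc j) z))" for j
  obtain f where f: "?steps (init A) z = Some f" "f \<in> finals A"
    using z by (auto simp: lang_def)
  have run_at: "?steps (init A) (take (Suc j) z) = Some (state j)"
    "?steps (state j) (drop (Suc j) z) = Some f" for j
    using f(1) steps_append_eq_Some_iff[of "delta A" "init A" "take (Suc j) z" "drop (Suc j) z" f]
    by (auto simp: state_def)
  have "state a \<noteq> state c"
    if shifts: "a \<in> shifts z" "b \<in> shifts z" "c \<in> shifts z" and "a < b" "b < c" for a b c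
  proof
    assume loop: "state a = state c"
    define d where "d = drop (Suc a) (take (Suc c) z)"
    have "take (Suc c) z = take (Suc a) z @ d"
      using \<open>a < b\<close> \<open>b < c\<close> append_take_drop_id[of "Suc a" "take (Suc c) z"]
      by (simp add: d_def min_def del: append_take_drop_id)
    then have "?steps (state a) d = Some (state a)"
      using run_at(1)[of c] run_at(1)[of a] loop by (auto simp: steps_append_eq_Some_iff)
    then have "shift d = 0"
      using shift_eq_0_if_loop[OF A(2) run_at(1)[of a] _ run_at(2)[of a] f(2)] by blast
    moreover have "b - Suc a \<in> shifts d"
      using shifts(2,3) \<open>a < b\<close> \<open>b < c\<close> by (auto simp: shifts_def d_def)
    ultimately show False
      by (auto simp: shift_eq_card_shifts finite_shifts)
  qed
  then have "card (shifts z) \<le> 2 * card (state ` shifts z)"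
    by (rule card_le_twice_card_image[OF finite_shifts])
  also have "card (state ` shifts z) \<le> card (states A)"
    using dfa_wf_steps_states[OF A(1) run_at(1)] A(1) by (intro card_mono) (auto simp: dfa_wf_def)
  finally show ?thesis by (simp add: shift_eq_card_shifts)
qed

section \<open>Parsing the two projections independently\<close>

text \<open>A word is read as a sequence of blocks of alternating direction, block \<open>l\<close> leading from the
  cut state \<open>s l\<close> to \<open>s (Suc l)\<close>. The input blocks are those with even number. The letters of one
  direction fill every second block only, which is what \<open>block_parse\<close> checks up to block \<open>l\<close>.\<close>

definition block_dir :: "nat \<Rightarrow> nat" where
  "block_dir l = Suc (l mod 2)"

lemma block_dir_simps [simp]:
  "block_dir 0 = 1" "block_dir (Suc 0) = 2" "block_dir (Suc (Suc l)) = block_dir l"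
  by (simp_all add: block_dir_def)

lemma block_dir_Suc_neq [simp]: "block_dir (Suc l) \<noteq> block_dir l" "block_dir l \<noteq> block_dir (Suc l)"
  unfolding block_dir_def by presburger+

lemma block_dir_cases: "d = 1 \<or> d = 2 \<Longrightarrow> d = block_dir l \<or> d = block_dir (Suc l)"
  unfolding block_dir_def by presburger

fun block_parse :: "(nat \<Rightarrow> letter \<Rightarrow> nat option) \<Rightarrow> (nat \<Rightarrow> nat) \<Rightarrow> nat \<Rightarrow> letter list \<Rightarrow> nat \<Rightarrow> bool"
where
  "block_parse \<delta> s 0 w q \<longleftrightarrow> steps \<delta> (s 0) w = Some q"
| "block_parse \<delta> s (Suc 0) w q \<longleftrightarrow> steps \<delta> (s (Suc 0)) w = Some q"
| "block_parse \<delta> s (Suc (Suc l)) w q \<longleftrightarrow>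
    (\<exists>u v. w = u @ v \<and> block_parse \<delta> s l u (s (Suc l)) \<and> steps \<delta> (s (Suc (Suc l))) v = Some q)"

lemma block_parse_snoc:
  assumes "block_parse \<delta> s l w p" "\<delta> p x = Some q" shows "block_parse \<delta> s l (w @ [x]) q"
proof -
  consider (first) "l = 0 \<or> l = Suc 0" | (later) l' where "l = Suc (Suc l')"
    by (metis not0_implies_Suc)
  then show ?thesis
  proof cases
    case first
    then show ?thesis using assms by (auto simp: steps_snoc_eq_Some_iff)
  next
    case later
    then obtain u v where "w = u @ v" "block_parse \<delta> s l' u (s (Suc l'))"
      "steps \<delta> (s (Suc (Suc l'))) v = Some p"
      using assms(1) by auto
    then show ?thesis
      using assms(2) unfolding later block_parse.simps
      by (intro exI[of _ u] exI[of _ "v @ [x]"]) (simp add: steps_snoc_eq_Some_iff)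
  qed
qed

lemma block_parse_next:
  "block_parse \<delta> s l w (s (Suc l)) \<Longrightarrow> block_parse \<delta> s (Suc (Suc l)) w (s (Suc (Suc l)))"
  unfolding block_parse.simps by (intro exI[of _ w] exI[of _ "[]"]) simp

lemma block_parse_cong:
  "(\<And>i. i \<le> l \<Longrightarrow> s i = s' i) \<Longrightarrow> block_parse \<delta> s l w q \<longleftrightarrow> block_parse \<delta> s' l w q"
  by (induction \<delta> s l w q rule: block_parse.induct) simp_all

lemma only_unidirectional:
  "set u \<subseteq> {d} \<times> UNIV \<Longrightarrow> only d u = u" "set u \<subseteq> {d} \<times> UNIV \<Longrightarrow> d \<noteq> d' \<Longrightarrow> only d' u = []"
  by (auto simp: filter_id_conv filter_empty_conv)

lemma block_parse_merge:
  assumes "block_parse \<delta> s l u (s (Suc l))" "block_parse \<delta> s (Suc l) v q"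
    and "set u \<subseteq> {block_dir l} \<times> UNIV" "set v \<subseteq> {block_dir (Suc l)} \<times> UNIV"
  shows "\<exists>z. steps \<delta> (s 0) z = Some q \<and> only (block_dir l) z = u \<and> only (block_dir (Suc l)) z = v"
  using assms
proof (induction l arbitrary: u v q)
  case 0
  then show ?case
    using only_unidirectional[OF 0(3)] only_unidirectional[OF 0(4)]
    by (intro exI[of _ "u @ v"]) (simp add: steps_append_eq_Some_iff)
next
  case (Suc l)
  obtain v0 v1 where v: "v = v0 @ v1" "block_parse \<delta> s l v0 (s (Suc l))"
    "steps \<delta> (s (Suc (Suc l))) v1 = Some q"
    using Suc.prems(2) by auto
  have "set v0 \<subseteq> {block_dir l} \<times> UNIV" and v1: "set v1 \<subseteq> {block_dir l} \<times> UNIV"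
    using Suc.prems(4) v(1) by auto
  then obtain z where "steps \<delta> (s 0) z = Some (s (Suc (Suc l)))" "only (block_dir l) z = v0"
    "only (block_dir (Suc l)) z = u"
    using Suc.IH[OF v(2) Suc.prems(1)] Suc.prems(3) by blast
  then show ?case
    using v only_unidirectional[OF v1]
    by (intro exI[of _ "z @ v1"]) (simp add: steps_append_eq_Some_iff)
qed

definition cut_parse :: "(nat \<Rightarrow> letter \<Rightarrow> nat option) \<Rightarrow> (nat \<Rightarrow> nat) \<Rightarrow> nat \<Rightarrow> letter list \<Rightarrow> nat \<Rightarrow> bool"
where
  "cut_parse \<delta> s l w q \<longleftrightarrow> block_parse \<delta> s l (only (block_dir l) w) (s (Suc l)) \<and>
     block_parse \<delta> s (Suc l) (only (block_dir (Suc l)) w) q"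

lemma cut_parse_cong:
  assumes "\<And>i. i \<le> Suc l \<Longrightarrow> s i = s' i"
  shows "cut_parse \<delta> s l w q \<longleftrightarrow> cut_parse \<delta> s' l w q"
  using assms block_parse_cong[of l s s'] block_parse_cong[of "Suc l" s s']
  by (simp add: cut_parse_def)

lemma cut_parse_sem_cong:
  assumes "sem z = sem w" shows "cut_parse \<delta> s l z q \<longleftrightarrow> cut_parse \<delta> s l w q"
proof -
  have "only (block_dir m) z = only (block_dir m) w" for m
  proof -
    have "block_dir m = 1 \<or> block_dir m = 2" unfolding block_dir_def by presburger
    then show ?thesis using assms unfolding sem_eq_iff by metis
  qed
  then show ?thesis by (simp add: cut_parse_def)
qed

lemma cut_parse_sound:
  assumes "cut_parse \<delta> s l w q"
  shows "\<exists>z. steps \<delta> (s 0) z = Some q \<and> sem z = sem w"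
proof -
  obtain z where z: "steps \<delta> (s 0) z = Some q"
    "only (block_dir l) z = only (block_dir l) w"
    "only (block_dir (Suc l)) z = only (block_dir (Suc l)) w"
    using block_parse_merge[of \<delta> s l "only (block_dir l) w" "only (block_dir (Suc l)) w" q] assms
    unfolding cut_parse_def by (force simp: subset_iff)
  have "only d z = only d w" if "d = 1 \<or> d = 2" for d
    using z(2,3) block_dir_cases[OF that] by metis
  then show ?thesis
    using z(1) by (auto simp: sem_eq_iff)
qed

definition cuttable :: "(nat \<Rightarrow> letter \<Rightarrow> nat option) \<Rightarrow> nat \<Rightarrow> nat \<Rightarrow> nat \<Rightarrow> letter list \<Rightarrow> nat \<Rightarrow> bool"
where
  "cuttable \<delta> n q0 l z q \<longleftrightarrow> (\<exists>s. s 0 = q0 \<and> (\<forall>i. s i < n) \<and> cut_parse \<delta> s l z q)"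

lemma cuttable_Nil: "q0 < n \<Longrightarrow> cuttable \<delta> n q0 0 [] q0"
  unfolding cuttable_def cut_parse_def by (intro exI[of _ "\<lambda>_. q0"]) simp

lemma cuttable_Suc:
  assumes "cuttable \<delta> n q0 l z q" "q < n" shows "cuttable \<delta> n q0 (Suc l) z q"
proof -
  obtain s where s: "s 0 = q0" "\<forall>i. s i < n" "cut_parse \<delta> s l z q"
    using assms(1) by (auto simp: cuttable_def)
  define s' where "s' = s(Suc (Suc l) := q)"
  have "cut_parse \<delta> s' l z q"
    using s(3) cut_parse_cong[of l s s'] by (simp add: s'_def)
  then have "cut_parse \<delta> s' (Suc l) z q"
    using block_parse_next[of \<delta> s' l] by (simp add: cut_parse_def s'_def del: block_parse.simps)
  then show ?thesis
    using s(1,2) assms(2) unfolding cuttable_def by (intro exI[of _ s']) (simp add: s'_def)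
qed

lemma cuttable_mono:
  assumes "cuttable \<delta> n q0 l z q" "q < n" "l \<le> l'" shows "cuttable \<delta> n q0 l' z q"
  using assms(3) by (induction rule: dec_induct) (use assms cuttable_Suc in auto)

lemma cuttable_snoc:
  assumes "cuttable \<delta> n q0 l z p" "\<delta> p x = Some q" "fst x = block_dir (Suc l)"
  shows "cuttable \<delta> n q0 l (z @ [x]) q"
  using assms block_parse_snoc[where \<delta> = \<delta> and p = p and x = x and q = q]
  unfolding cuttable_def cut_parse_def by (auto simp del: block_parse.simps)

lemma cuttable_of_steps:
  assumes \<delta>: "\<And>q x p. \<delta> q x = Some p \<Longrightarrow> (fst x = 1 \<or> fst x = 2) \<and> p < n"
    and "q0 < n" "steps \<delta> q0 z = Some q"
  shows "\<exists>l \<le> shift z + of_bool (z \<noteq> []). cuttable \<delta> n q0 l z q \<and>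
    (z \<noteq> [] \<longrightarrow> fst (last z) = block_dir (Suc l))"
  using assms(3)
proof (induction z arbitrary: q rule: rev_induct)
  case Nil
  then show ?case using cuttable_Nil[OF assms(2)] by simp
next
  case (snoc x z)
  obtain p where p: "steps \<delta> q0 z = Some p" "\<delta> p x = Some q"
    using snoc.prems by (auto simp: steps_snoc_eq_Some_iff)
  obtain l where l: "l \<le> shift z + of_bool (z \<noteq> [])" "cuttable \<delta> n q0 l z p"
    and last: "z \<noteq> [] \<longrightarrow> fst (last z) = block_dir (Suc l)"
    using snoc.IH[OF p(1)] by blast
  have "p < n" using p(1) assms(2) \<delta>
    by (cases z rule: rev_cases) (auto simp: steps_snoc_eq_Some_iff)
  consider (same_block) "fst x = block_dir (Suc l)" | (next_block) "fst x = block_dir l"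
    using block_dir_cases \<delta>[OF p(2)] by blast
  then show ?case
  proof cases
    case same_block
    then have "l \<le> shift (z @ [x]) + 1"
      using l(1) shift_append_ge[of z "[x]"] by (cases "z = []") auto
    then show ?thesis
      using cuttable_snoc[OF l(2) p(2) same_block] same_block by (intro exI[of _ l]) simp
  next
    case next_block
    have "Suc l \<le> shift (z @ [x]) + 1"
      using l(1) last next_block by (cases "z = []") (auto simp: shift_append)
    then show ?thesis
      using cuttable_snoc[OF cuttable_Suc[OF l(2) \<open>p < n\<close>] p(2)] next_block
      by (intro exI[of _ "Suc l"]) simp
  qed
qed

definition digit :: "nat \<Rightarrow> nat \<Rightarrow> nat \<Rightarrow> nat" where
  "digit n t j = t div n ^ j mod n"

lemma ex_digits:
  assumes "\<And>j. s j < n" shows "\<exists>t<n ^ m. \<forall>j<m. digit n t j = s j"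
  using assms
proof (induction m arbitrary: s)
  case (Suc m)
  obtain t where t: "t < n ^ m" "\<forall>j<m. digit n t j = s (Suc j)"
    using Suc.IH[of "\<lambda>j. s (Suc j)"] Suc.prems by auto
  let ?t = "s 0 + n * t"
  have "?t < n * Suc t" using Suc.prems[of 0] by simp
  also have "\<dots> \<le> n * n ^ m" using t(1) by (intro mult_le_mono2) simp
  finally have "?t < n ^ Suc m" by simp
  moreover have "digit n ?t j = s j" if "j < Suc m" for j
    using that t(2) Suc.prems[of 0] by (cases j) (auto simp: digit_def div_mult2_eq)
  ultimately show ?case by blast
qed simp

text \<open>The first letter of a word is put into block \<open>1\<close> or \<open>2\<close>, and each of at most \<open>2 * n\<close> shifts moves on
  by one block, so that \<open>Suc (last_cut n)\<close> is the last block.\<close>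

definition last_cut :: "nat \<Rightarrow> nat" where
  "last_cut n = Suc (2 * n)"

lemma sem_in_sem_set_iff_cut_parse:
  assumes A: "dfa_wf k A" "states A = {0..<n}" and fin: "finite_shift (lang A)"
  shows "sem w \<in> sem_set (lang A) \<longleftrightarrow> (\<exists>t<n ^ (last_cut n + 2). \<exists>q\<in>finals A.
    digit n t 0 = init A \<and> cut_parse (delta A) (digit n t) (last_cut n) w q)"
    (is "?in \<longleftrightarrow> ?cut")
proof
  assume ?in
  then obtain z q where z: "z \<in> lang A" "sem z = sem w"
    and q: "steps (delta A) (init A) z = Some q" "q \<in> finals A"
    by (auto simp: sem_set_def lang_def)
  have n: "init A < n" "q < n"
    and \<delta>: "delta A r x = Some p \<Longrightarrow> (fst x = 1 \<or> fst x = 2) \<and> p < n" for r x p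
    using A q(2) dfa_wf_delta[OF A(1), of r x p] by (auto simp: dfa_wf_def Sigma_io_def)
  obtain l where l: "l \<le> shift z + of_bool (z \<noteq> [])" "cuttable (delta A) n (init A) l z q"
    using cuttable_of_steps[OF _ n(1) q(1)] \<delta> by blast
  have "shift z \<le> 2 * n"
    using shift_le_twice_card_states[OF A(1) fin z(1)] A(2) by simp
  then have "l \<le> last_cut n"
    using l(1) by (cases "z = []") (auto simp: last_cut_def)
  from cuttable_mono[OF l(2) n(2) this]
  obtain s where s: "s 0 = init A" "\<And>i. s i < n" "cut_parse (delta A) s (last_cut n) w q"
    unfolding cuttable_def cut_parse_sem_cong[OF z(2)] by blast
  obtain t where "t < n ^ (last_cut n + 2)" "\<forall>j<last_cut n + 2. digit n t j = s j"
    using ex_digits[of s n "last_cut n + 2", OF s(2)] by blast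
  then show ?cut
    using s cut_parse_cong[of "last_cut n" "digit n t" s] q(2) by (intro exI[of _ t]) auto
next
  assume ?cut
  then obtain z q where "steps (delta A) (init A) z = Some q" "sem z = sem w" "q \<in> finals A"
    using cut_parse_sound by metis
  then show ?in
    unfolding sem_set_def lang_def by (metis (mono_tags, lifting) imageI mem_Collect_eq)
qed

section \<open>The subset construction on numbers\<close>

locale bounded_nfa =
  fixes bound :: nat and initial :: "nat \<Rightarrow> bool" and eps :: "nat \<Rightarrow> nat \<Rightarrow> bool"
    and move :: "nat \<Rightarrow> letter \<Rightarrow> nat \<Rightarrow> bool"
begin

inductive run :: "letter list \<Rightarrow> nat \<Rightarrow> bool" where
  run_init: "initial q \<Longrightarrow> q < bound \<Longrightarrow> run [] q"
| run_eps: "run w p \<Longrightarrow> eps p q \<Longrightarrow> q < bound \<Longrightarrow> run w q"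
| run_move: "run w p \<Longrightarrow> move p x q \<Longrightarrow> q < bound \<Longrightarrow> run (w @ [x]) q"

definition eps_closure :: "nat \<Rightarrow> nat \<Rightarrow> bool" where
  "eps_closure = (\<lambda>p q. eps p q \<and> q < bound)\<^sup>*\<^sup>*"

definition subset_init :: nat where
  "subset_init = set_encode {q \<in> {..<bound}. \<exists>p<bound. initial p \<and> eps_closure p q}"

definition subset_step :: "nat \<Rightarrow> letter \<Rightarrow> nat" where
  "subset_step X x = set_encode {q \<in> {..<bound}.
     \<exists>p<bound. \<exists>r<bound. p \<in> set_decode X \<and> move p x r \<and> eps_closure r q}"

lemma run_less: "run w q \<Longrightarrow> q < bound"
  by (induction rule: run.induct)

lemma run_eps_closure: "eps_closure p q \<Longrightarrow> run w p \<Longrightarrow> run w q"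
  unfolding eps_closure_def by (induction rule: rtranclp_induct) (auto intro: run_eps)

lemma run_append_if_loop:
  assumes "run w q" "\<And>x. x \<in> set v \<Longrightarrow> move q x q" shows "run (w @ v) q"
  using assms(2)
proof (induction v rule: rev_induct)
  case (snoc x v)
  then show ?case
    using run_move[of "w @ v" q x q] run_less[OF assms(1)] by simp
qed (simp add: assms(1))

lemma eps_closure_refl: "eps_closure p p"
  by (simp add: eps_closure_def)

lemma eps_closure_snoc: "eps_closure p q \<Longrightarrow> eps q r \<Longrightarrow> r < bound \<Longrightarrow> eps_closure p r"
  unfolding eps_closure_def by (rule rtranclp.rtrancl_into_rtrancl) auto

lemma run_Nil_iff: "run [] q \<longleftrightarrow> q < bound \<and> (\<exists>p<bound. initial p \<and> eps_closure p q)"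
proof
  have "v = [] \<Longrightarrow> q < bound \<and> (\<exists>p<bound. initial p \<and> eps_closure p q)" if "run v q" for v
    using that by (induction rule: run.induct) (auto intro: eps_closure_refl eps_closure_snoc)
  then show "run [] q \<Longrightarrow> q < bound \<and> (\<exists>p<bound. initial p \<and> eps_closure p q)" by blast
qed (auto intro: run_init run_eps_closure)

lemma run_snoc_iff:
  "run (w @ [x]) q \<longleftrightarrow> q < bound \<and> (\<exists>p<bound. \<exists>r<bound. run w p \<and> move p x r \<and> eps_closure r q)"
proof
  have "v = w @ [x] \<Longrightarrow> q < bound \<and> (\<exists>p<bound. \<exists>r<bound. run w p \<and> move p x r \<and> eps_closure r q)"
    if "run v q" for v
    using that
  proof (induction rule: run.induct)
    case (run_eps v p q)
    then show ?case by (metis eps_closure_snoc)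
  next
    case (run_move v p y q)
    then show ?case by (metis append1_eq_conv eps_closure_refl run_less)
  qed simp
  then show "run (w @ [x]) q \<Longrightarrow>
      q < bound \<and> (\<exists>p<bound. \<exists>r<bound. run w p \<and> move p x r \<and> eps_closure r q)" by blast
qed (auto intro: run_move run_eps_closure)

lemma foldl_subset_step_iff_run: "q \<in> set_decode (foldl subset_step subset_init w) \<longleftrightarrow> run w q"
  by (induction w arbitrary: q rule: rev_induct)
    (simp_all add: subset_init_def subset_step_def run_Nil_iff run_snoc_iff)

lemma subset_init_less: "subset_init < 2 ^ bound"
  unfolding subset_init_def by (rule set_encode_less) auto

lemma subset_step_less: "subset_step X x < 2 ^ bound"
  unfolding subset_step_def by (rule set_encode_less) auto

end

context
  fixes bound :: "nat \<Rightarrow> nat" and eps :: "nat \<Rightarrow> nat \<Rightarrow> nat \<Rightarrow> bool"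
  assumes bound: "computable 1 (\<lambda>e. bound (e 0))"
    and eps: "decidable 3 (\<lambda>e. eps (e 0) (e 1) (e 2))"
begin

lemma decidable_eps_closure:
  "decidable 3 (\<lambda>e. bounded_nfa.eps_closure (bound (e 0)) (eps (e 0)) (e 1) (e 2))"
  unfolding bounded_nfa.eps_closure_def
proof (rule decidable_rtranclp[where r = "\<lambda>v p q. eps v p q \<and> q < bound v", OF bound])
  show "decidable 3 (\<lambda>e. eps (e 0) (e 1) (e 2) \<and> e 2 < bound (e 0))"
    by (intro computable_intros eps computable_comp1[of bound, OF bound]) simp_all
qed (auto intro: computable_var)

lemmas subset_intros = computable_intros computable_comp1[of bound, OF bound]
  computable_comp3[of "\<lambda>v p q. of_bool (bounded_nfa.eps_closure (bound v) (eps v) p q)",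
    OF decidable_eps_closure]

lemma computable_subset_init:
  assumes "decidable 2 (\<lambda>e. initial (e 0) (e 1))"
  shows "computable 1 (\<lambda>e. bounded_nfa.subset_init (bound (e 0)) (initial (e 0)) (eps (e 0)))"
  unfolding bounded_nfa.subset_init_def
  by (intro subset_intros computable_comp2[of "\<lambda>v p. of_bool (initial v p)", OF assms]) simp_all

lemma computable_subset_step:
  assumes "decidable 5 (\<lambda>e. move (e 0) (e 1) (e 2, e 3) (e 4))"
  shows "computable 4
    (\<lambda>e. bounded_nfa.subset_step (bound (e 0)) (eps (e 0)) (move (e 0)) (e 1) (e 2, e 3))"
  unfolding bounded_nfa.subset_step_def
  by (intro subset_intros computable_comp5[of "\<lambda>v p d a q. of_bool (move v p (d, a) q)", OF assms])
    simp_all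

end

section \<open>Automata for the target, the domain and the relation\<close>

definition domain_eps :: "nat \<Rightarrow> (nat \<Rightarrow> letter \<Rightarrow> nat \<Rightarrow> bool) \<Rightarrow> nat \<Rightarrow> nat \<Rightarrow> bool" where
  "domain_eps k \<tau> p q \<longleftrightarrow> (\<exists>a<k. \<tau> p (2, a) q)"

definition domain_move :: "(nat \<Rightarrow> letter \<Rightarrow> nat \<Rightarrow> bool) \<Rightarrow> nat \<Rightarrow> letter \<Rightarrow> nat \<Rightarrow> bool" where
  "domain_move \<tau> p x q \<longleftrightarrow> (fst x = 1 \<longrightarrow> \<tau> p x q) \<and> (fst x \<noteq> 1 \<longrightarrow> q = p)"

text \<open>A node of the automaton for the relation consists of a guessed tuple of cut states, coded by
  the digits of its first component, a block number, and a state inside this block.\<close>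

definition cut_node :: "nat \<Rightarrow> nat \<Rightarrow> nat \<Rightarrow> nat" where
  "cut_node t l q = prod_encode (t, prod_encode (l, q))"

abbreviation node_tuple :: "nat \<Rightarrow> nat" where "node_tuple z \<equiv> fst_decode z"
abbreviation node_block :: "nat \<Rightarrow> nat" where "node_block z \<equiv> fst_decode (snd_decode z)"
abbreviation node_state :: "nat \<Rightarrow> nat" where "node_state z \<equiv> snd_decode (snd_decode z)"

definition tuple_bound :: "nat \<Rightarrow> nat" where
  "tuple_bound n = n ^ (last_cut n + 2)"

definition cut_bound :: "nat \<Rightarrow> nat" where
  "cut_bound n = cut_node (tuple_bound n) (last_cut n + 2) n"

definition cut_init :: "nat \<Rightarrow> nat \<Rightarrow> nat \<Rightarrow> bool" where
  "cut_init n q0 z \<longleftrightarrow> digit n (node_tuple z) 0 = q0 \<and> node_block z < 2 \<and>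
     node_state z = digit n (node_tuple z) (node_block z)"

definition cut_eps :: "nat \<Rightarrow> nat \<Rightarrow> nat \<Rightarrow> bool" where
  "cut_eps n z z' \<longleftrightarrow> node_tuple z' = node_tuple z \<and> node_block z' = Suc (Suc (node_block z)) \<and>
     node_state z = digit n (node_tuple z) (Suc (node_block z)) \<and>
     node_state z' = digit n (node_tuple z) (node_block z')"

definition cut_move :: "(nat \<Rightarrow> letter \<Rightarrow> nat \<Rightarrow> bool) \<Rightarrow> nat \<Rightarrow> letter \<Rightarrow> nat \<Rightarrow> bool" where
  "cut_move \<tau> z x z' \<longleftrightarrow> node_tuple z' = node_tuple z \<and> node_block z' = node_block z \<and>
     (fst x = block_dir (node_block z) \<longrightarrow> \<tau> (node_state z) x (node_state z')) \<and>
     (fst x \<noteq> block_dir (node_block z) \<longrightarrow> node_state z' = node_state z)"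

lemma filter_eq_appendE:
  assumes "filter P w = u @ v"
  obtains w0 w1 where "w = w0 @ w1" "filter P w0 = u" "filter P w1 = v"
  using assms
proof (induction u arbitrary: w thesis)
  case Nil
  then show ?case by (metis append_Nil filter.simps(1))
next
  case (Cons x u)
  then obtain w0 w1 where w: "w = w0 @ x # w1" "\<forall>y\<in>set w0. \<not> P y" "P x" "filter P w1 = u @ v"
    using filter_eq_ConsD[of P w x "u @ v"] by auto
  obtain w2 w3 where "w1 = w2 @ w3" "filter P w2 = u" "filter P w3 = v"
    using Cons.IH[OF _ w(4)] by blast
  then show ?case
    using w by (intro Cons.prems(1)[of "w0 @ x # w2" w3]) (auto simp: filter_empty_conv)
qed

locale numbered_dfa =
  fixes k n :: nat and A :: dfa
  assumes wf: "dfa_wf k A" and states: "states A = {0..<n}"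
begin

abbreviation moves_to :: "nat \<Rightarrow> letter \<Rightarrow> nat \<Rightarrow> bool" where
  "moves_to p x q \<equiv> delta A p x = Some q"

lemma init_less: "init A < n"
  using wf states by (simp add: dfa_wf_def)

lemma finals_less: "q \<in> finals A \<Longrightarrow> q < n"
  using wf states by (auto simp: dfa_wf_def)

lemma delta_less: "moves_to p x q \<Longrightarrow> q < n"
  using dfa_wf_delta(3)[OF wf, of p x q] states by simp

lemma steps_less: "steps (delta A) p w = Some q \<Longrightarrow> p < n \<Longrightarrow> q < n"
  using dfa_wf_steps_states[OF wf] states by simp

lemma digit_less: "digit n t j < n"
  using init_less by (simp add: digit_def)

sublocale lang_nfa: bounded_nfa n "\<lambda>q. q = init A" "\<lambda>_ _. False" moves_to .

sublocale domain_nfa: bounded_nfa n "\<lambda>q. q = init A" "domain_eps k moves_to"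
  "domain_move moves_to" .

sublocale cut_nfa: bounded_nfa "cut_bound n" "cut_init n (init A)" "cut_eps n" "cut_move moves_to" .

lemma lang_run_iff: "lang_nfa.run w q \<longleftrightarrow> steps (delta A) (init A) w = Some q"
proof
  show "lang_nfa.run w q \<Longrightarrow> steps (delta A) (init A) w = Some q"
    by (induction rule: lang_nfa.run.induct) (auto simp: steps_snoc_eq_Some_iff)
  show "steps (delta A) (init A) w = Some q \<Longrightarrow> lang_nfa.run w q"
  proof (induction w arbitrary: q rule: rev_induct)
    case (snoc x w)
    then obtain p where "steps (delta A) (init A) w = Some p" "moves_to p x q"
      by (auto simp: steps_snoc_eq_Some_iff)
    then show ?case
      using lang_nfa.run_move snoc.IH delta_less by blast
  qed (simp add: lang_nfa.run_init init_less)
qed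

lemma domain_run_sound:
  assumes "domain_nfa.run w q"
  shows "\<exists>z. steps (delta A) (init A) z = Some q \<and> proj_i z = proj_i w"
  using assms
proof (induction rule: domain_nfa.run.induct)
  case (run_init q)
  then show ?case by (intro exI[of _ "[]"]) simp
next
  case (run_eps w p q)
  then obtain z a where "steps (delta A) (init A) z = Some p" "proj_i z = proj_i w"
    "moves_to p (2, a) q"
    by (auto simp: domain_eps_def)
  then show ?case by (intro exI[of _ "z @ [(2, a)]"]) (simp add: steps_snoc_eq_Some_iff)
next
  case (run_move w p x q)
  then obtain z where z: "steps (delta A) (init A) z = Some p" "proj_i z = proj_i w" by blast
  show ?case
  proof (cases "fst x = 1")
    case True
    then show ?thesis using z run_move.hyps(2)
      by (intro exI[of _ "z @ [x]"]) (simp add: domain_move_def steps_snoc_eq_Some_iff)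
  next
    case False
    then show ?thesis using z run_move.hyps(2) by (auto simp: domain_move_def)
  qed
qed

lemma domain_run_append_outputs:
  assumes "domain_nfa.run w q" "proj_i y = []" shows "domain_nfa.run (w @ y) q"
proof (rule domain_nfa.run_append_if_loop[OF assms(1)])
  show "domain_move moves_to q x q" if "x \<in> set y" for x
    using assms(2) that by (auto simp: proj_i_def domain_move_def filter_empty_conv)
qed

lemma domain_run_complete:
  assumes "steps (delta A) (init A) z = Some q" "proj_i z = proj_i w"
  shows "domain_nfa.run w q"
  using assms
proof (induction z arbitrary: w q rule: rev_induct)
  case Nil
  then have "domain_nfa.run [] q"
    using domain_nfa.run_init init_less by simp
  then show ?case
    using domain_run_append_outputs[of "[]" q w] Nil.prems(2) by simp
next
  case (snoc x z)
  then obtain p where p: "steps (delta A) (init A) z = Some p" "moves_to p x q"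
    by (auto simp: steps_snoc_eq_Some_iff)
  show ?case
  proof (cases "fst x = 1")
    case True
    then have "proj_i w = proj_i z @ [snd x]" using snoc.prems(2) by simp
    then obtain v y where w: "w = v @ (1, snd x) # y" "proj_i z = proj_i v" "proj_i y = []"
      unfolding proj_i_eq_snoc_iff by metis
    have "domain_move moves_to p (1, snd x) q"
      using p(2) True by (cases x) (simp add: domain_move_def)
    then have "domain_nfa.run (v @ [(1, snd x)]) q"
      using domain_nfa.run_move[OF snoc.IH[OF p(1) w(2)]] delta_less[OF p(2)] by blast
    then show ?thesis
      using domain_run_append_outputs[OF _ w(3)] w(1) by fastforce
  next
    case False
    then have "domain_eps k moves_to p q"
      using p(2) dfa_wf_delta(2)[OF wf p(2)] by (cases x) (auto simp: Sigma_io_def domain_eps_def)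
    then show ?thesis
      using domain_nfa.run_eps[OF snoc.IH[OF p(1)]] snoc.prems(2) False delta_less[OF p(2)] by simp
  qed
qed

lemma domain_run_iff:
  "domain_nfa.run w q \<longleftrightarrow> (\<exists>z. steps (delta A) (init A) z = Some q \<and> proj_i z = proj_i w)"
  using domain_run_sound domain_run_complete by blast

lemma cut_run_sound:
  assumes "cut_nfa.run w z"
  shows "digit n (node_tuple z) 0 = init A \<and>
    block_parse (delta A) (digit n (node_tuple z)) (node_block z)
      (only (block_dir (node_block z)) w) (node_state z)"
  using assms
proof (induction rule: cut_nfa.run.induct)
  case (run_init z)
  then show ?case by (auto simp: cut_init_def less_2_cases_iff)
next
  case (run_eps w z z')
  then show ?case
    using block_parse_next[of "delta A" "digit n (node_tuple z)" "node_block z"]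
    by (simp add: cut_eps_def del: block_parse.simps)
next
  case (run_move w z x z')
  then show ?case
    using block_parse_snoc[of "delta A" "digit n (node_tuple z)" "node_block z" _ "node_state z"
        x "node_state z'"]
    by (cases "fst x = block_dir (node_block z)") (simp_all add: cut_move_def)
qed

lemma cut_node_less_bound:
  "t < tuple_bound n \<Longrightarrow> l < last_cut n + 2 \<Longrightarrow> q < n \<Longrightarrow> cut_node t l q < cut_bound n"
  unfolding cut_bound_def cut_node_def
  by (intro prod_encode_strict_mono less_imp_le[OF prod_encode_strict_mono] less_imp_le)

context
  fixes t :: nat
  assumes tuple: "t < tuple_bound n"
begin

lemma cut_run_append:
  assumes "cut_nfa.run w (cut_node t l p)" "l < last_cut n + 2" "p < n"
    and "steps (delta A) p (only (block_dir l) v) = Some q"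
  shows "cut_nfa.run (w @ v) (cut_node t l q)"
  using assms(4)
proof (induction v arbitrary: q rule: rev_induct)
  case Nil
  then show ?case using assms(1) by simp
next
  case (snoc x v)
  then obtain r where r: "steps (delta A) p (only (block_dir l) v) = Some r"
    "if fst x = block_dir l then moves_to r x q else q = r"
    by (auto simp: steps_snoc_eq_Some_iff split: if_splits)
  have "q < n" using steps_less[OF snoc.prems assms(3)] .
  have "cut_move moves_to (cut_node t l r) x (cut_node t l q)"
    using r(2) by (auto simp: cut_move_def cut_node_def split: if_splits)
  then show ?case
    using cut_nfa.run_move[OF snoc.IH[OF r(1)]] cut_node_less_bound[OF tuple assms(2) \<open>q < n\<close>]
    by simp
qed

lemma cut_run_Nil:
  assumes "digit n t 0 = init A" "l < 2" shows "cut_nfa.run [] (cut_node t l (digit n t l))"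
  using assms cut_node_less_bound[OF tuple _ digit_less]
  by (intro cut_nfa.run_init) (simp_all add: cut_init_def cut_node_def)

lemma cut_run_first_blocks:
  assumes "digit n t 0 = init A" "l < 2"
    and "steps (delta A) (digit n t l) (only (block_dir l) w) = Some q"
  shows "cut_nfa.run w (cut_node t l q)"
  using cut_run_append[OF cut_run_Nil[OF assms(1,2)] _ digit_less assms(3)] assms(2) by simp

lemma cut_run_complete:
  assumes "digit n t 0 = init A" "l < last_cut n + 2"
    and "block_parse (delta A) (digit n t) l (only (block_dir l) w) q"
  shows "cut_nfa.run w (cut_node t l q)"
  using assms(2,3)
proof (induction l arbitrary: w q rule: induct_nat_012)
  case 0
  then show ?case using cut_run_first_blocks[OF assms(1)] by simp
next
  case 1
  then show ?case using cut_run_first_blocks[OF assms(1)] by simp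
next
  case (ge2 l)
  obtain u v where uv: "only (block_dir l) w = u @ v"
    "block_parse (delta A) (digit n t) l u (digit n t (Suc l))"
    "steps (delta A) (digit n t (Suc (Suc l))) v = Some q"
    using ge2.prems(2) by auto
  from uv(1) obtain w0 w1 where w: "w = w0 @ w1"
    "only (block_dir l) w0 = u" "only (block_dir l) w1 = v"
    by (rule filter_eq_appendE)
  have "cut_eps n (cut_node t l (digit n t (Suc l)))
      (cut_node t (Suc (Suc l)) (digit n t (Suc (Suc l))))"
    by (simp add: cut_eps_def cut_node_def)
  then have "cut_nfa.run w0 (cut_node t (Suc (Suc l)) (digit n t (Suc (Suc l))))"
    using cut_nfa.run_eps[OF ge2.IH(1)[of w0 "digit n t (Suc l)"]] ge2.prems(1) uv(2) w(2)
      cut_node_less_bound[OF tuple ge2.prems(1) digit_less] by simp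
  from cut_run_append[OF this ge2.prems(1) digit_less, of w1 q] show ?case
    using uv(3) w by simp
qed

lemma cut_run_iff:
  assumes "l < last_cut n + 2"
  shows "cut_nfa.run w (cut_node t l q) \<longleftrightarrow> digit n t 0 = init A \<and>
    block_parse (delta A) (digit n t) l (only (block_dir l) w) q"
  using cut_run_sound[of w "cut_node t l q"] cut_run_complete[OF _ assms]
  by (auto simp: cut_node_def)

end

lemma in_lang_iff_run: "w \<in> lang A \<longleftrightarrow> (\<exists>q<n. q \<in> finals A \<and> lang_nfa.run w q)"
  using finals_less by (auto simp: lang_def lang_run_iff)

lemma in_Domain_iff_run:
  "proj_i w \<in> Domain (sem_set (lang A)) \<longleftrightarrow> (\<exists>q<n. q \<in> finals A \<and> domain_nfa.run w q)"
  using finals_less by (auto simp: Domain_sem_set image_iff lang_def domain_run_iff) metis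

lemma sem_in_sem_set_iff_cut_run:
  assumes "finite_shift (lang A)"
  shows "sem w \<in> sem_set (lang A) \<longleftrightarrow> (\<exists>t<tuple_bound n. \<exists>q<n. q \<in> finals A \<and>
    cut_nfa.run w (cut_node t (last_cut n) (digit n t (Suc (last_cut n)))) \<and>
    cut_nfa.run w (cut_node t (Suc (last_cut n)) q))"
proof -
  have "digit n t 0 = init A \<and> cut_parse (delta A) (digit n t) (last_cut n) w q \<longleftrightarrow>
      cut_nfa.run w (cut_node t (last_cut n) (digit n t (Suc (last_cut n)))) \<and>
      cut_nfa.run w (cut_node t (Suc (last_cut n)) q)" if "t < tuple_bound n" for t q
    using cut_run_iff[OF that, of "last_cut n" w] cut_run_iff[OF that, of "Suc (last_cut n)" w]
    by (auto simp: cut_parse_def)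
  then show ?thesis
    unfolding sem_in_sem_set_iff_cut_parse[OF wf states assms] tuple_bound_def[symmetric]
    using finals_less by blast
qed

end

section \<open>The game\<close>

text \<open>In the positions of \<open>W\<close> an input letter has just been read. The output written next passes an
  accepting position \<open>q\<close> if the input so far is in the domain, and stops at \<open>r\<close> to read again.
  Viability is tested without writing, because \<open>in_domain\<close> will depend on the input projection only.\<close>

locale arena =
  fixes k bound start :: nat and step :: "nat \<Rightarrow> letter \<Rightarrow> nat"
    and accepting in_domain :: "nat \<Rightarrow> bool"
begin

definition reads :: "nat \<Rightarrow> nat \<Rightarrow> nat \<Rightarrow> bool" where
  "reads d = (\<lambda>p q. \<exists>a<k. q = step p (d, a))\<^sup>*\<^sup>*"

definition viable :: "nat \<Rightarrow> bool" where
  "viable p \<longleftrightarrow> (\<exists>q. reads 1 p q \<and> in_domain q)"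

definition answerable :: "nat set \<Rightarrow> nat \<Rightarrow> bool" where
  "answerable W p \<longleftrightarrow> (\<exists>q r. reads 2 p q \<and> reads 2 q r \<and> (in_domain p \<longrightarrow> accepting q) \<and>
     (\<forall>a<k. viable (step r (1, a)) \<longrightarrow> step r (1, a) \<in> W))"

definition winning :: bool where
  "winning \<longleftrightarrow> (\<exists>W\<subseteq>{..<bound}. start \<in> W \<and> (\<forall>p\<in>W. answerable W p))"

lemma reads_iff_foldl: "reads d p q \<longleftrightarrow> (\<exists>u. set u \<subseteq> {..<k} \<and> q = foldl step p (map (Pair d) u))"
  (is "_ \<longleftrightarrow> ?word q")
proof
  assume "reads d p q"
  then show "?word q"
    unfolding reads_def
  proof (induction rule: rtranclp_induct)
    case base
    show ?case by (intro exI[of _ "[]"]) simp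
  next
    case (step q r)
    then obtain u a where "set u \<subseteq> {..<k}" "q = foldl step p (map (Pair d) u)"
      "a < k" "r = step q (d, a)"
      by blast
    then show ?case by (intro exI[of _ "u @ [a]"]) simp
  qed
next
  assume "?word q"
  then obtain u where "set u \<subseteq> {..<k}" "q = foldl step p (map (Pair d) u)" by blast
  then show "reads d p q"
  proof (induction u arbitrary: q rule: rev_induct)
    case (snoc a u)
    then have "reads d p (foldl step p (map (Pair d) u))" by simp
    then show ?case
      unfolding reads_def by (rule rtranclp.rtrancl_into_rtrancl) (use snoc.prems in auto)
  qed (simp add: reads_def)
qed

abbreviation position :: "letter list \<Rightarrow> nat" where
  "position \<equiv> foldl step start"

abbreviation after_output :: "nat \<Rightarrow> nat list \<Rightarrow> nat" where
  "after_output p y \<equiv> foldl step p (outputs y)"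

end

context
  fixes k bound start :: "nat \<Rightarrow> nat" and step :: "nat \<Rightarrow> nat \<Rightarrow> letter \<Rightarrow> nat"
    and accepting in_domain :: "nat \<Rightarrow> nat \<Rightarrow> bool"
  assumes k: "computable 1 (\<lambda>e. k (e 0))" and bound: "computable 1 (\<lambda>e. bound (e 0))"
    and start: "computable 1 (\<lambda>e. start (e 0))"
    and step: "computable 4 (\<lambda>e. step (e 0) (e 1) (e 2, e 3))"
    and accepting: "decidable 2 (\<lambda>e. accepting (e 0) (e 1))"
    and in_domain: "decidable 2 (\<lambda>e. in_domain (e 0) (e 1))"
    and step_less: "\<And>v p x. step v p x < bound v"
begin

lemmas arena_intros = computable_intros computable_comp1[of k, OF k]
  computable_comp1[of bound, OF bound] computable_comp1[of start, OF start]
  computable_comp4[of "\<lambda>v p d a. step v p (d, a)", OF step]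
  computable_comp2[of "\<lambda>v p. of_bool (accepting v p)", OF accepting]
  computable_comp2[of "\<lambda>v p. of_bool (in_domain v p)", OF in_domain]

lemma decidable_reads:
  assumes "computable m v" "computable m f" "computable m g"
  shows "decidable m (\<lambda>e. arena.reads (k (v e)) (step (v e)) d (f e) (g e))"
  unfolding arena.reads_def
proof (rule decidable_rtranclp[where r = "\<lambda>v p q. \<exists>a<k v. q = step v p (d, a)", OF bound _ _ assms])
  show "decidable 3 (\<lambda>e. \<exists>a<k (e 0). e 2 = step (e 0) (e 1) (d, a))"
    by (intro arena_intros) simp_all
qed (use step_less in blast)

lemma reads_less: "arena.reads (k v) (step v) d p q \<Longrightarrow> q < bound v + Suc p"
  unfolding arena.reads_def by (erule rtranclp_less_add_Suc) (use step_less in blast)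

lemma decidable_viable:
  assumes "computable m v" "computable m f"
  shows "decidable m (\<lambda>e. arena.viable (k (v e)) (step (v e)) (in_domain (v e)) (f e))"
proof -
  have "arena.viable (k v) (step v) (in_domain v) p \<longleftrightarrow>
      (\<exists>q<bound v + Suc p. arena.reads (k v) (step v) 1 p q \<and> in_domain v q)" for v p
    unfolding arena.viable_def using reads_less by blast
  moreover have "decidable 2 (\<lambda>e. \<exists>q<bound (e 0) + Suc (e 1).
      arena.reads (k (e 0)) (step (e 0)) 1 (e 1) q \<and> in_domain (e 0) q)"
    by (intro arena_intros decidable_reads) simp_all
  ultimately have "decidable 2 (\<lambda>e. arena.viable (k (e 0)) (step (e 0)) (in_domain (e 0)) (e 1))"
    by simp
  from computable_comp2[of "\<lambda>v p. of_bool (arena.viable (k v) (step v) (in_domain v) p)",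
      OF this assms]
  show ?thesis .
qed

lemma decidable_answerable:
  assumes "computable m v" "computable m W" "computable m f"
  shows "decidable m (\<lambda>e. arena.answerable (k (v e)) (step (v e)) (accepting (v e))
    (in_domain (v e)) (set_decode (W e)) (f e))"
proof -
  let ?reads = "\<lambda>v. arena.reads (k v) (step v)"
    and ?viable = "\<lambda>v. arena.viable (k v) (step v) (in_domain v)"
    and ?answerable = "\<lambda>v c. arena.answerable (k v) (step v) (accepting v) (in_domain v)
      (set_decode c)"
  let ?bounded = "\<lambda>v c p. \<exists>q<bound v + Suc p. \<exists>r<bound v + Suc q.
    ?reads v 2 p q \<and> ?reads v 2 q r \<and> (in_domain v p \<longrightarrow> accepting v q) \<and>
    (\<forall>a<k v. ?viable v (step v r (1, a)) \<longrightarrow> step v r (1, a) \<in> set_decode c)"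
  have "?answerable v c p \<longleftrightarrow> ?bounded v c p" for v c p
    unfolding arena.answerable_def using reads_less by blast
  moreover have "decidable 3 (\<lambda>e. ?bounded (e 0) (e 1) (e 2))"
    by (intro arena_intros decidable_reads decidable_viable) simp_all
  ultimately have "decidable 3 (\<lambda>e. ?answerable (e 0) (e 1) (e 2))"
    by simp
  from computable_comp3[of "\<lambda>v c p. of_bool (?answerable v c p)", OF this assms] show ?thesis .
qed

lemma decidable_winning:
  "decidable 1 (\<lambda>e. arena.winning (k (e 0)) (bound (e 0)) (start (e 0)) (step (e 0))
    (accepting (e 0)) (in_domain (e 0)))"
proof -
  let ?answerable = "\<lambda>v. arena.answerable (k v) (step v) (accepting v) (in_domain v)"
  have "arena.winning (k v) (bound v) (start v) (step v) (accepting v) (in_domain v) \<longleftrightarrow>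
      (\<exists>c<2 ^ bound v. start v \<in> set_decode c \<and>
        (\<forall>p<bound v. p \<in> set_decode c \<longrightarrow> ?answerable v (set_decode c) p))" for v
    unfolding arena.winning_def ex_subset_iff_ex_code using set_decode_subset by blast
  moreover have "decidable 1 (\<lambda>e. \<exists>c<2 ^ bound (e 0). start (e 0) \<in> set_decode c \<and>
      (\<forall>p<bound (e 0). p \<in> set_decode c \<longrightarrow> ?answerable (e 0) (set_decode c) p))"
    by (intro arena_intros decidable_answerable) simp_all
  ultimately show ?thesis by simp
qed

end

locale synchronized_game = arena +
  fixes T :: "letter list set" and R :: "(nat list \<times> nat list) set"
  assumes start_less: "start < bound" and step_less: "step p x < bound"
    and accepting_iff: "w \<in> lists (Sigma_io k) \<Longrightarrow> accepting (position w) \<longleftrightarrow> w \<in> T \<and> sem w \<in> R"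
    and in_domain_iff: "w \<in> lists (Sigma_io k) \<Longrightarrow> in_domain (position w) \<longleftrightarrow> proj_i w \<in> Domain R"
    and Domain_letters: "u \<in> Domain R \<Longrightarrow> set u \<subseteq> {..<k}"
begin

lemma position_less: "position w < bound"
  by (cases w rule: rev_cases) (simp_all add: start_less step_less)

lemma viable_iff:
  assumes "w \<in> lists (Sigma_io k)"
  shows "viable (position w) \<longleftrightarrow> (\<exists>u. proj_i w @ u \<in> Domain R)"
proof -
  have "in_domain (foldl step (position w) (inputs u)) \<longleftrightarrow> proj_i w @ u \<in> Domain R"
    if "set u \<subseteq> {..<k}" for u
    using in_domain_iff[of "w @ inputs u"] assms inputs_in_lists_Sigma_io[OF that] by simp
  moreover have "set u \<subseteq> {..<k}" if "proj_i w @ u \<in> Domain R" for u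
    using Domain_letters[OF that] by simp
  ultimately show ?thesis
    unfolding viable_def reads_iff_foldl by blast
qed

end

section \<open>A sequential uniformizer yields a winning set\<close>

locale sequential_uniformizer = synchronized_game +
  fixes A :: dfa
  assumes wf: "dfa_wf k A" and sequential: "sequential A" and lang_subset: "lang A \<subseteq> T"
    and uniformization: "uniformization (sem_set (lang A)) R"
begin

definition ready_runs :: "letter list set" where
  "ready_runs = {w \<in> runs A. w = [] \<or> fst (last w) = 1}"

lemma ready_runs_letters: "w \<in> ready_runs \<Longrightarrow> w \<in> lists (Sigma_io k)"
  using runs_letters[OF wf] by (simp add: ready_runs_def)

lemma ready_run_extends:
  assumes w: "w \<in> ready_runs" and "proj_i w @ u \<in> Domain R"
  obtains v where "w @ v \<in> lang A" "proj_i v = u" "v \<in> lists (Sigma_io k)"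
proof -
  obtain w' where w': "w' \<in> lang A" "proj_i w' = proj_i w @ u"
    using assms(2) uniformization unfolding uniformization_def Domain_sem_set by (metis imageE)
  have "w' \<in> runs A" using w'(1) lang_subset_runs by blast
  then have "prefix w w'"
    using w w'(2) sequential_run_prefix[OF wf sequential, of w w'] by (simp add: ready_runs_def)
  then obtain v where v: "w' = w @ v" by (auto elim: prefixE)
  then have "v \<in> lists (Sigma_io k)" using runs_letters[OF wf \<open>w' \<in> runs A\<close>] by simp
  then show ?thesis using that v w' by simp
qed

lemma ready_run_accepting_output:
  assumes w: "w \<in> ready_runs"
  obtains y where "set y \<subseteq> {..<k}" "w @ outputs y \<in> runs A"
    "in_domain (position w) \<longrightarrow> accepting (position (w @ outputs y))"
proof (cases "in_domain (position w)")
  case True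
  then have "proj_i w @ [] \<in> Domain R"
    using in_domain_iff[OF ready_runs_letters[OF w]] by simp
  then obtain v where v: "w @ v \<in> lang A" "proj_i v = []" "v \<in> lists (Sigma_io k)"
    using ready_run_extends[OF w] by blast
  then obtain y where y: "v = outputs y" "set y \<subseteq> {..<k}"
    using proj_i_eq_Nil_iff by blast
  have "sem (w @ v) \<in> R"
    using uniformization v(1) by (auto simp: uniformization_def sem_set_def)
  then have "accepting (position (w @ v))"
    using accepting_iff[of "w @ v"] ready_runs_letters[OF w] v lang_subset by auto
  then show ?thesis using that y v(1) lang_subset_runs by blast
next
  case False
  then show ?thesis using that[of "[]"] w by (simp add: ready_runs_def)
qed

lemma ready_run_next_output:
  assumes w: "w \<in> ready_runs" and "proj_i w @ a # u \<in> Domain R"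
  obtains x where "set x \<subseteq> {..<k}" "w @ outputs x @ [(1, a)] \<in> runs A"
proof -
  obtain v where v: "w @ v \<in> lang A" "proj_i v = a # u" "v \<in> lists (Sigma_io k)"
    using ready_run_extends[OF assms] by blast
  obtain y v' where y: "v = y @ (1, a) # v'" "proj_i y = []"
    using v(2) unfolding proj_i_eq_Cons_iff by blast
  then obtain x where x: "y = outputs x" "set x \<subseteq> {..<k}"
    using v(3) proj_i_eq_Nil_iff[of y k] by auto
  have "(w @ outputs x @ [(1, a)]) @ v' \<in> runs A"
    using subsetD[OF lang_subset_runs v(1)] y(1) x(1) by simp
  then show ?thesis using that x(2) runs_prefix by blast
qed

lemma ready_run_common_output:
  assumes w: "w \<in> ready_runs" and y: "set y \<subseteq> {..<k}" "w @ outputs y \<in> runs A"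
  obtains x where "set x \<subseteq> {..<k}" "prefix y x"
    "\<And>a u. proj_i w @ a # u \<in> Domain R \<Longrightarrow> w @ outputs x @ [(1, a)] \<in> runs A"
proof (cases "\<exists>a u. proj_i w @ a # u \<in> Domain R")
  case True
  then obtain a u where "proj_i w @ a # u \<in> Domain R" by blast
  then obtain x where x: "set x \<subseteq> {..<k}" "w @ outputs x @ [(1, a)] \<in> runs A"
    using ready_run_next_output[OF w] by blast
  have "w @ outputs x @ [(1, b)] \<in> runs A" if b: "proj_i w @ b # u' \<in> Domain R" for b u'
  proof -
    obtain x' where x': "w @ outputs x' @ [(1, b)] \<in> runs A"
      using ready_run_next_output[OF w b] by blast
    have "w @ outputs x \<in> runs A" "w @ outputs x' \<in> runs A"
      using x(2) x' runs_prefix[of "w @ outputs _"] by auto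
    then have "prefix x x'" "prefix x' x"
      using sequential_output_before_input[OF wf sequential] x(2) x' by blast+
    then have "x = x'" by (rule prefix_order.antisym)
    then show ?thesis using x' by simp
  qed
  then show ?thesis
    using that x sequential_output_before_input[OF wf sequential y(2) x(2)] by blast
qed (use that y(1) in blast)

lemma answerable_ready_run:
  assumes w: "w \<in> ready_runs"
  shows "answerable (position ` ready_runs) (position w)"
proof -
  obtain y where y: "set y \<subseteq> {..<k}" "w @ outputs y \<in> runs A"
    "in_domain (position w) \<longrightarrow> accepting (position (w @ outputs y))"
    using ready_run_accepting_output[OF w] .
  obtain x where x: "set x \<subseteq> {..<k}" "prefix y x"
    and next_run: "\<And>a u. proj_i w @ a # u \<in> Domain R \<Longrightarrow> w @ outputs x @ [(1, a)] \<in> runs A"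
    using ready_run_common_output[OF w y(1,2)] by blast
  obtain z where z: "x = y @ z" using x(2) by (auto elim: prefixE)
  have "position (w @ outputs x @ [(1, a)]) \<in> position ` ready_runs"
    if "a < k" "viable (position (w @ outputs x @ [(1, a)]))" for a
  proof (rule imageI)
    have "w @ outputs x @ [(1, a)] \<in> lists (Sigma_io k)"
      using ready_runs_letters[OF w] outputs_in_lists_Sigma_io[OF x(1)] that(1)
      by (simp add: Sigma_io_def)
    then have "\<exists>u. proj_i w @ a # u \<in> Domain R"
      using viable_iff[of "w @ outputs x @ [(1, a)]"] that(2) by simp
    then have "w @ outputs x @ [(1, a)] \<in> runs A"
      using next_run by blast
    then show "w @ outputs x @ [(1, a)] \<in> ready_runs" by (simp add: ready_runs_def)
  qed
  then show ?thesis
    unfolding answerable_def reads_iff_foldl using x(1) y(1,3) z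
    by (intro exI[of _ "position (w @ outputs y)"] exI[of _ "position (w @ outputs x)"]) auto
qed

lemma winning: winning
  unfolding winning_def
proof (intro exI conjI ballI)
  show "position ` ready_runs \<subseteq> {..<bound}" using position_less by blast
  show "start \<in> position ` ready_runs"
    by (rule image_eqI[of _ _ "[]"]) (simp_all add: ready_runs_def runs_def)
qed (use answerable_ready_run in blast)

end

section \<open>A winning set yields a sequential uniformizer\<close>

locale winning_strategy = synchronized_game +
  fixes W :: "nat set" and early late :: "nat \<Rightarrow> nat list"
  assumes W_subset: "W \<subseteq> {..<bound}" and start_in_W: "start \<in> W"
    and early_letters: "set (early p) \<subseteq> {..<k}" and late_letters: "set (late p) \<subseteq> {..<k}"
    and accepting_early: "p \<in> W \<Longrightarrow> in_domain p \<Longrightarrow> accepting (after_output p (early p))"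
    and next_in_W: "p \<in> W \<Longrightarrow> a < k \<Longrightarrow>
      viable (step (after_output p (early p @ late p)) (1, a)) \<Longrightarrow>
      step (after_output p (early p @ late p)) (1, a) \<in> W"
begin

definition answer :: "nat \<Rightarrow> nat list" where
  "answer p = early p @ late p"

definition exit :: "nat \<Rightarrow> nat" where
  "exit p = after_output p (answer p)"

definition play :: "nat list \<Rightarrow> letter list" where
  "play = foldl (\<lambda>w a. w @ outputs (answer (position w)) @ [(1, a)]) []"

abbreviation arrival :: "nat list \<Rightarrow> nat" where
  "arrival u \<equiv> position (play u)"

definition feasible :: "nat list \<Rightarrow> bool" where
  "feasible u \<longleftrightarrow> u = [] \<or> (\<exists>u'. u @ u' \<in> Domain R)"

lemma play_Nil [simp]: "play [] = []"
  and play_snoc: "play (u @ [a]) = play u @ outputs (answer (arrival u)) @ [(1, a)]"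
  by (simp_all add: play_def)

lemma answer_letters: "set (answer p) \<subseteq> {..<k}"
  using early_letters late_letters by (simp add: answer_def)

lemma proj_i_play [simp]: "proj_i (play u) = u"
  by (induction u rule: rev_induct) (simp_all add: play_snoc)

lemma play_letters: "set u \<subseteq> {..<k} \<Longrightarrow> play u \<in> lists (Sigma_io k)"
  using outputs_in_lists_Sigma_io[OF answer_letters]
  by (induction u rule: rev_induct) (auto simp: play_snoc Sigma_io_def)

lemma arrival_snoc: "arrival (u @ [a]) = step (exit (arrival u)) (1, a)"
  by (simp add: play_snoc exit_def)

lemma feasible_letters: "feasible u \<Longrightarrow> set u \<subseteq> {..<k}"
  using Domain_letters by (force simp: feasible_def)

lemma feasible_if_in_Domain: "u \<in> Domain R \<Longrightarrow> feasible u"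
  unfolding feasible_def by (metis append_Nil2)

lemma feasible_snocD: "feasible (u @ [a]) \<Longrightarrow> feasible u"
  by (auto simp: feasible_def)

lemma feasible_snoc_iff:
  assumes "feasible u" "a < k"
  shows "feasible (u @ [a]) \<longleftrightarrow> viable (step (exit (arrival u)) (1, a))"
  using viable_iff[OF play_letters[of "u @ [a]"]] feasible_letters[OF assms(1)] assms(2)
  by (simp add: arrival_snoc feasible_def)

lemma arrival_in_W: "feasible u \<Longrightarrow> arrival u \<in> W"
proof (induction u rule: rev_induct)
  case (snoc a u)
  have "feasible u" "a < k"
    using feasible_snocD[OF snoc.prems] feasible_letters[OF snoc.prems] by simp_all
  then show ?case
    using snoc feasible_snoc_iff next_in_W unfolding arrival_snoc exit_def answer_def by blast
qed (simp add: start_in_W)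

lemma in_domain_arrival_iff: "feasible u \<Longrightarrow> in_domain (arrival u) \<longleftrightarrow> u \<in> Domain R"
  using in_domain_iff[OF play_letters] feasible_letters by simp

text \<open>The state \<open>(p, j)\<close> has entered position \<open>p\<close> and written \<open>j\<close> letters of the answer to it.\<close>

definition strategy_delta :: "nat \<Rightarrow> letter \<Rightarrow> nat option" where
  "strategy_delta s x = (let (p, j) = prod_decode s in
     if p \<in> W \<and> j < length (answer p) \<and> x = (2, answer p ! j) then Some (prod_encode (p, Suc j))
     else if p \<in> W \<and> j = length (answer p) \<and> fst x = 1 \<and> snd x < k \<and> viable (step (exit p) x)
     then Some (prod_encode (step (exit p) x, 0)) else None)"

definition strategy_dfa :: dfa where
  "strategy_dfa = (prod_encode ` (SIGMA p:W. {..length (answer p)}), prod_encode (start, 0),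
     strategy_delta, {prod_encode (p, length (early p)) | p. p \<in> W \<and> in_domain p})"

lemma strategy_dfa_simps [simp]:
  "states strategy_dfa = prod_encode ` (SIGMA p:W. {..length (answer p)})"
  "init strategy_dfa = prod_encode (start, 0)" "delta strategy_dfa = strategy_delta"
  "finals strategy_dfa = {prod_encode (p, length (early p)) | p. p \<in> W \<and> in_domain p}"
  by (simp_all add: strategy_dfa_def)

abbreviation strategy_run :: "letter list \<Rightarrow> nat \<Rightarrow> nat \<Rightarrow> bool" where
  "strategy_run w p j \<equiv> steps strategy_delta (prod_encode (start, 0)) w = Some (prod_encode (p, j))"

lemma strategy_delta_eq_Some_iff:
  "strategy_delta (prod_encode (p, j)) x = Some s \<longleftrightarrow> p \<in> W \<and>
    (j < length (answer p) \<and> x = (2, answer p ! j) \<and> s = prod_encode (p, Suc j) \<or>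
     j = length (answer p) \<and> (\<exists>a<k. x = (1, a) \<and> viable (step (exit p) (1, a)) \<and>
       s = prod_encode (step (exit p) (1, a), 0)))"
  by (cases x) (auto simp: strategy_delta_def)

lemma dfa_wf_strategy_dfa: "dfa_wf k strategy_dfa"
  unfolding dfa_wf_def
proof (intro conjI allI impI)
  show "finite (states strategy_dfa)"
    using finite_subset[OF W_subset] by simp
  show "init strategy_dfa \<in> states strategy_dfa"
    using start_in_W by auto
  show "finals strategy_dfa \<subseteq> states strategy_dfa"
    by (auto simp: answer_def)
  fix s x s' assume "delta strategy_dfa s x = Some s'"
  moreover obtain p j where s: "s = prod_encode (p, j)"
    by (metis prod.exhaust prod_decode_inverse)
  ultimately have "p \<in> W" and
    "j < length (answer p) \<and> x = (2, answer p ! j) \<and> s' = prod_encode (p, Suc j) \<or>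
     j = length (answer p) \<and> (\<exists>a<k. x = (1, a) \<and> viable (step (exit p) (1, a)) \<and>
       s' = prod_encode (step (exit p) (1, a), 0))"
    by (simp_all add: strategy_delta_eq_Some_iff)
  then show "s \<in> states strategy_dfa" "x \<in> Sigma_io k" "s' \<in> states strategy_dfa"
    using answer_letters[of p] next_in_W[of p] s
    by (auto simp: Sigma_io_def exit_def answer_def[symmetric] subset_iff)
qed

lemma sequential_strategy_dfa: "sequential strategy_dfa"
  unfolding sequential_def
proof (intro exI conjI ballI allI impI)
  let ?Qi = "prod_encode ` (SIGMA p:W. {length (answer p)})"
  let ?Qo = "prod_encode ` (SIGMA p:W. {..<length (answer p)})"
  show "?Qi \<union> ?Qo = states strategy_dfa" by force
  show "?Qi \<inter> ?Qo = {}" by auto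
  show "fst x = 1" if "s \<in> ?Qi" "delta strategy_dfa s x \<noteq> None" for s x
    using that by (auto simp: strategy_delta_eq_Some_iff)
  show "fst x = 2" if "s \<in> ?Qo" "delta strategy_dfa s x \<noteq> None" for s x
    using that by (auto simp: strategy_delta_eq_Some_iff)
  show "x = y"
    if "s \<in> ?Qo" "delta strategy_dfa s x \<noteq> None \<and> delta strategy_dfa s y \<noteq> None" for s x y
    using that by (auto simp: strategy_delta_eq_Some_iff)
qed

lemma strategy_steps_sound:
  assumes "steps strategy_delta (prod_encode (start, 0)) w = Some s"
  shows "\<exists>u j. feasible u \<and> j \<le> length (answer (arrival u)) \<and>
    w = play u @ outputs (take j (answer (arrival u))) \<and> s = prod_encode (arrival u, j)"
  using assms
proof (induction w arbitrary: s rule: rev_induct)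
  case Nil
  then show ?case by (intro exI[of _ "[]"] exI[of _ 0]) (simp add: feasible_def)
next
  case (snoc x w)
  then obtain r where "steps strategy_delta (prod_encode (start, 0)) w = Some r"
    "strategy_delta r x = Some s"
    unfolding steps_snoc_eq_Some_iff by blast
  with snoc.IH obtain u j where u: "feasible u"
    and w: "w = play u @ outputs (take j (answer (arrival u)))"
    and move: "strategy_delta (prod_encode (arrival u, j)) x = Some s"
    by blast
  consider (writing) "j < length (answer (arrival u))" "x = (2, answer (arrival u) ! j)"
      "s = prod_encode (arrival u, Suc j)"
    | (reading) a where "j = length (answer (arrival u))" "a < k" "x = (1, a)"
      "viable (step (exit (arrival u)) (1, a))"
      "s = prod_encode (step (exit (arrival u)) (1, a), 0)"
    using move unfolding strategy_delta_eq_Some_iff by blast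
  then show ?case
  proof cases
    case writing
    then show ?thesis using u w
      by (intro exI[of _ u] exI[of _ "Suc j"]) (simp add: take_Suc_conv_app_nth)
  next
    case reading
    then show ?thesis using feasible_snoc_iff[OF u reading(2)] w
      by (intro exI[of _ "u @ [a]"] exI[of _ 0]) (simp add: play_snoc exit_def)
  qed
qed

lemma strategy_steps_answer:
  assumes "p \<in> W" "j \<le> length (answer p)"
  shows "steps strategy_delta (prod_encode (p, 0)) (outputs (take j (answer p))) =
    Some (prod_encode (p, j))"
  using assms(2)
proof (induction j)
  case (Suc j)
  then show ?case
    using assms(1)
    by (simp add: take_Suc_conv_app_nth steps_snoc_eq_Some_iff strategy_delta_eq_Some_iff)
qed simp

lemma strategy_run_append_answer:
  assumes "strategy_run w p 0" "p \<in> W" "j \<le> length (answer p)"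
  shows "strategy_run (w @ outputs (take j (answer p))) p j"
  using assms(1) strategy_steps_answer[OF assms(2,3)] unfolding steps_append_eq_Some_iff by blast

lemma strategy_run_play: "feasible u \<Longrightarrow> strategy_run (play u) (arrival u) 0"
proof (induction u rule: rev_induct)
  case (snoc a u)
  let ?p = "arrival u"
  have u: "feasible u" "a < k"
    using feasible_snocD[OF snoc.prems] feasible_letters[OF snoc.prems] by simp_all
  have "strategy_run (play u @ outputs (answer ?p)) ?p (length (answer ?p))"
    using strategy_run_append_answer[OF snoc.IH[OF u(1)] arrival_in_W[OF u(1)] order_refl] by simp
  moreover have "strategy_delta (prod_encode (?p, length (answer ?p))) (1, a) =
      Some (prod_encode (step (exit ?p) (1, a), 0))"
    using arrival_in_W[OF u(1)] feasible_snoc_iff[OF u] snoc.prems u(2)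
    by (simp add: strategy_delta_eq_Some_iff)
  ultimately have "strategy_run ((play u @ outputs (answer ?p)) @ [(1, a)])
      (step (exit ?p) (1, a)) 0"
    unfolding steps_snoc_eq_Some_iff by blast
  then show ?case by (simp add: play_snoc exit_def)
qed simp

lemma lang_strategy_dfa:
  "lang strategy_dfa = {play u @ outputs (early (arrival u)) | u. u \<in> Domain R}"
proof (intro set_eqI iffI)
  fix w assume "w \<in> lang strategy_dfa"
  then obtain p where run: "strategy_run w p (length (early p))" and "in_domain p"
    by (auto simp: lang_def)
  from strategy_steps_sound[OF run] obtain u where "feasible u" "p = arrival u"
    "w = play u @ outputs (take (length (early p)) (answer p))"
    by auto
  then show "w \<in> {play u @ outputs (early (arrival u)) | u. u \<in> Domain R}"
    using in_domain_arrival_iff \<open>in_domain p\<close> by (auto simp: answer_def)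
next
  fix w assume "w \<in> {play u @ outputs (early (arrival u)) | u. u \<in> Domain R}"
  then obtain u where u: "u \<in> Domain R" and w: "w = play u @ outputs (early (arrival u))"
    by blast
  note feasible = feasible_if_in_Domain[OF u]
  have "strategy_run w (arrival u) (length (early (arrival u)))"
    using strategy_run_append_answer[OF strategy_run_play[OF feasible] arrival_in_W[OF feasible],
        of "length (early (arrival u))"]
    by (simp add: answer_def w)
  moreover have "arrival u \<in> W \<and> in_domain (arrival u)"
    using arrival_in_W[OF feasible] in_domain_arrival_iff[OF feasible] u by simp
  ultimately show "w \<in> lang strategy_dfa" by (auto simp: lang_def)
qed

lemma lang_strategy_dfa_accepted:
  assumes "w \<in> lang strategy_dfa" shows "w \<in> T \<and> sem w \<in> R"
proof -
  obtain u where u: "u \<in> Domain R" and w: "w = play u @ outputs (early (arrival u))"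
    using assms unfolding lang_strategy_dfa by blast
  note feasible = feasible_if_in_Domain[OF u]
  have "accepting (position w)"
    using accepting_early[OF arrival_in_W[OF feasible]] in_domain_arrival_iff[OF feasible] u w
    by simp
  moreover have "w \<in> lists (Sigma_io k)"
    using play_letters[OF Domain_letters[OF u]] outputs_in_lists_Sigma_io[OF early_letters] w
    by simp
  ultimately show ?thesis using accepting_iff by blast
qed

lemma uniformization_strategy_dfa: "uniformization (sem_set (lang strategy_dfa)) R"
  unfolding uniformization_def
proof (intro conjI)
  show "sem_set (lang strategy_dfa) \<subseteq> R"
    using lang_strategy_dfa_accepted by (auto simp: sem_set_def)
  show "single_valued (sem_set (lang strategy_dfa))"
    by (auto simp: single_valued_def sem_set_def sem_def lang_strategy_dfa)
  show "Domain (sem_set (lang strategy_dfa)) = Domain R"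
    by (simp add: Domain_sem_set lang_strategy_dfa Setcompr_eq_image image_image)
qed

end

context synchronized_game
begin

lemma ex_winning_strategy_if_winning:
  assumes winning
  obtains W early late where
    "winning_strategy k bound start step accepting in_domain T R W early late"
proof -
  obtain W where W: "W \<subseteq> {..<bound}" "start \<in> W" "\<And>p. p \<in> W \<Longrightarrow> answerable W p"
    using assms unfolding winning_def by blast
  have "\<exists>y z. set y \<subseteq> {..<k} \<and> set z \<subseteq> {..<k} \<and> (p \<in> W \<longrightarrow>
      (in_domain p \<longrightarrow> accepting (after_output p y)) \<and>
      (\<forall>a<k. viable (step (after_output p (y @ z)) (1, a)) \<longrightarrow>
        step (after_output p (y @ z)) (1, a) \<in> W))" for p
  proof (cases "p \<in> W")
    case True
    then obtain y z where "set y \<subseteq> {..<k}" "set z \<subseteq> {..<k}"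
      "in_domain p \<longrightarrow> accepting (after_output p y)"
      "\<forall>a<k. viable (step (after_output (after_output p y) z) (1, a)) \<longrightarrow>
        step (after_output (after_output p y) z) (1, a) \<in> W"
      using W(3) unfolding answerable_def reads_iff_foldl by blast
    then show ?thesis by (intro exI[of _ y] exI[of _ z]) simp
  qed (intro exI[of _ "[]"], simp)
  then obtain early late where "\<And>p. set (early p) \<subseteq> {..<k} \<and> set (late p) \<subseteq> {..<k} \<and> (p \<in> W \<longrightarrow>
      (in_domain p \<longrightarrow> accepting (after_output p (early p))) \<and>
      (\<forall>a<k. viable (step (after_output p (early p @ late p)) (1, a)) \<longrightarrow>
        step (after_output p (early p @ late p)) (1, a) \<in> W))"
    by metis
  then have "winning_strategy k bound start step accepting in_domain T R W early late"
    using W(1,2) by unfold_locales blast+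
  then show ?thesis by (rule that)
qed

theorem winning_iff_ex_sequential_uniformizer:
  "winning \<longleftrightarrow> (\<exists>A. dfa_wf k A \<and> sequential A \<and> lang A \<subseteq> T \<and> uniformization (sem_set (lang A)) R)"
proof
  assume winning
  then obtain W early late where
    "winning_strategy k bound start step accepting in_domain T R W early late"
    by (rule ex_winning_strategy_if_winning)
  then interpret winning_strategy k bound start step accepting in_domain T R W early late .
  show "\<exists>A. dfa_wf k A \<and> sequential A \<and> lang A \<subseteq> T \<and> uniformization (sem_set (lang A)) R"
    using dfa_wf_strategy_dfa sequential_strategy_dfa lang_strategy_dfa_accepted
      uniformization_strategy_dfa by blast
next
  assume "\<exists>A. dfa_wf k A \<and> sequential A \<and> lang A \<subseteq> T \<and> uniformization (sem_set (lang A)) R"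
  then obtain A where "dfa_wf k A" "sequential A" "lang A \<subseteq> T" "uniformization (sem_set (lang A)) R"
    by blast
  then interpret sequential_uniformizer k bound start step accepting in_domain T R A
    by unfold_locales
  show winning by (rule winning)
qed

end

section \<open>The game of an input\<close>

abbreviation num_states :: "nat \<Rightarrow> nat" where "num_states c \<equiv> fst_decode c"
abbreviation start_state :: "nat \<Rightarrow> nat" where "start_state c \<equiv> fst_decode (snd_decode c)"
abbreviation final_list :: "nat \<Rightarrow> nat" where "final_list c \<equiv> fst_decode (snd_decode (snd_decode c))"
abbreviation table :: "nat \<Rightarrow> nat" where "table c \<equiv> snd_decode (snd_decode (snd_decode c))"

definition code_delta :: "nat \<Rightarrow> nat \<Rightarrow> nat \<Rightarrow> letter \<Rightarrow> nat \<Rightarrow> bool" where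
  "code_delta k c q x q' \<longleftrightarrow> q < num_states c \<and> (fst x = 1 \<or> fst x = 2) \<and> snd x < k \<and>
     q' < num_states c \<and> code_nth (q * (2 * k) + (fst x - 1) * k + snd x) (table c) = q'"

lemma decidable_code_delta [computable_intros]:
  assumes "computable m k" "computable m c" "computable m q" "computable m d" "computable m a"
    "computable m q'"
  shows "decidable m (\<lambda>e. code_delta (k e) (c e) (q e) (d e, a e) (q' e))"
  unfolding code_delta_def fst_conv snd_conv by (intro computable_intros assms)

lemma computable_digit [computable_intros]:
  assumes "computable m n" "computable m t" "computable m j"
  shows "computable m (\<lambda>e. digit (n e) (t e) (j e))"
  unfolding digit_def by (intro computable_intros assms)

lemma computable_last_cut [computable_intros]:
  assumes "computable m n" shows "computable m (\<lambda>e. last_cut (n e))"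
  unfolding last_cut_def by (intro computable_intros assms)

lemma computable_tuple_bound [computable_intros]:
  assumes "computable m n" shows "computable m (\<lambda>e. tuple_bound (n e))"
  unfolding tuple_bound_def by (intro computable_intros assms)

lemma computable_cut_node [computable_intros]:
  assumes "computable m t" "computable m l" "computable m q"
  shows "computable m (\<lambda>e. cut_node (t e) (l e) (q e))"
  unfolding cut_node_def by (intro computable_intros assms)

lemma computable_cut_bound [computable_intros]:
  assumes "computable m n" shows "computable m (\<lambda>e. cut_bound (n e))"
  unfolding cut_bound_def by (intro computable_intros assms)

abbreviation alphabet :: "nat \<Rightarrow> nat" where "alphabet v \<equiv> fst_decode v"
abbreviation source :: "nat \<Rightarrow> nat" where "source v \<equiv> fst_decode (snd_decode v)"
abbreviation target :: "nat \<Rightarrow> nat" where "target v \<equiv> snd_decode (snd_decode v)"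

abbreviation source_delta :: "nat \<Rightarrow> nat \<Rightarrow> letter \<Rightarrow> nat \<Rightarrow> bool" where
  "source_delta v \<equiv> code_delta (alphabet v) (source v)"

abbreviation target_delta :: "nat \<Rightarrow> nat \<Rightarrow> letter \<Rightarrow> nat \<Rightarrow> bool" where
  "target_delta v \<equiv> code_delta (alphabet v) (target v)"

definition target_start :: "nat \<Rightarrow> nat" where
  "target_start v = bounded_nfa.subset_init (num_states (target v))
     (\<lambda>q. q = start_state (target v)) (\<lambda>_ _. False)"

definition target_step :: "nat \<Rightarrow> nat \<Rightarrow> letter \<Rightarrow> nat" where
  "target_step v = bounded_nfa.subset_step (num_states (target v)) (\<lambda>_ _. False) (target_delta v)"

definition domain_start :: "nat \<Rightarrow> nat" where
  "domain_start v = bounded_nfa.subset_init (num_states (source v))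
     (\<lambda>q. q = start_state (source v)) (domain_eps (alphabet v) (source_delta v))"

definition domain_step :: "nat \<Rightarrow> nat \<Rightarrow> letter \<Rightarrow> nat" where
  "domain_step v = bounded_nfa.subset_step (num_states (source v))
     (domain_eps (alphabet v) (source_delta v)) (domain_move (source_delta v))"

definition cut_start :: "nat \<Rightarrow> nat" where
  "cut_start v = bounded_nfa.subset_init (cut_bound (num_states (source v)))
     (cut_init (num_states (source v)) (start_state (source v))) (cut_eps (num_states (source v)))"

definition cut_step :: "nat \<Rightarrow> nat \<Rightarrow> letter \<Rightarrow> nat" where
  "cut_step v = bounded_nfa.subset_step (cut_bound (num_states (source v)))
     (cut_eps (num_states (source v))) (cut_move (source_delta v))"

text \<open>A position consists of three sets of states, one for each of these automata.\<close>

abbreviation target_part :: "nat \<Rightarrow> nat" where "target_part p \<equiv> fst_decode p"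
abbreviation domain_part :: "nat \<Rightarrow> nat" where "domain_part p \<equiv> fst_decode (snd_decode p)"
abbreviation cut_part :: "nat \<Rightarrow> nat" where "cut_part p \<equiv> snd_decode (snd_decode p)"

definition position_start :: "nat \<Rightarrow> nat" where
  "position_start v = prod_encode (target_start v, prod_encode (domain_start v, cut_start v))"

definition position_step :: "nat \<Rightarrow> nat \<Rightarrow> letter \<Rightarrow> nat" where
  "position_step v p x = prod_encode (target_step v (target_part p) x,
     prod_encode (domain_step v (domain_part p) x, cut_step v (cut_part p) x))"

definition position_bound :: "nat \<Rightarrow> nat" where
  "position_bound v = prod_encode (2 ^ num_states (target v),
     prod_encode (2 ^ num_states (source v), 2 ^ cut_bound (num_states (source v))))"

definition position_in_target :: "nat \<Rightarrow> nat \<Rightarrow> bool" where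
  "position_in_target v p \<longleftrightarrow> (\<exists>q<num_states (target v).
     code_member q (final_list (target v)) \<and> q \<in> set_decode (target_part p))"

definition position_in_domain :: "nat \<Rightarrow> nat \<Rightarrow> bool" where
  "position_in_domain v p \<longleftrightarrow> (\<exists>q<num_states (source v).
     code_member q (final_list (source v)) \<and> q \<in> set_decode (domain_part p))"

definition position_in_relation :: "nat \<Rightarrow> nat \<Rightarrow> bool" where
  "position_in_relation v p \<longleftrightarrow> (let n = num_states (source v) in
     \<exists>t<tuple_bound n. \<exists>q<n. code_member q (final_list (source v)) \<and>
       cut_node t (last_cut n) (digit n t (Suc (last_cut n))) \<in> set_decode (cut_part p) \<and>
       cut_node t (Suc (last_cut n)) q \<in> set_decode (cut_part p))"

definition winning_input :: "nat \<Rightarrow> bool" where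
  "winning_input v \<longleftrightarrow>
     arena.winning (alphabet v) (position_bound v) (position_start v) (position_step v)
       (\<lambda>p. position_in_target v p \<and> position_in_relation v p) (position_in_domain v)"

lemma decidable_domain_eps:
  "decidable 3 (\<lambda>e. domain_eps (alphabet (e 0)) (source_delta (e 0)) (e 1) (e 2))"
  unfolding domain_eps_def by (intro computable_intros) simp_all

lemma decidable_domain_move:
  "decidable 5 (\<lambda>e. domain_move (source_delta (e 0)) (e 1) (e 2, e 3) (e 4))"
  unfolding domain_move_def fst_conv by (intro computable_intros) simp_all

lemma decidable_cut_eps: "decidable 3 (\<lambda>e. cut_eps (num_states (source (e 0))) (e 1) (e 2))"
  unfolding cut_eps_def by (intro computable_intros) simp_all

lemma decidable_cut_move:
  "decidable 5 (\<lambda>e. cut_move (source_delta (e 0)) (e 1) (e 2, e 3) (e 4))"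
  unfolding cut_move_def block_dir_def fst_conv by (intro computable_intros) simp_all

lemma computable_target_start: "computable 1 (\<lambda>e. target_start (e 0))"
  unfolding target_start_def by (intro computable_subset_init computable_intros) simp_all

lemma computable_target_step: "computable 4 (\<lambda>e. target_step (e 0) (e 1) (e 2, e 3))"
  unfolding target_step_def by (intro computable_subset_step computable_intros) simp_all

lemma computable_domain_start: "computable 1 (\<lambda>e. domain_start (e 0))"
  unfolding domain_start_def
  by (intro computable_subset_init decidable_domain_eps computable_intros) simp_all

lemma computable_domain_step: "computable 4 (\<lambda>e. domain_step (e 0) (e 1) (e 2, e 3))"
  unfolding domain_step_def
  by (intro computable_subset_step decidable_domain_eps decidable_domain_move computable_intros)
    simp_all

lemma computable_cut_start: "computable 1 (\<lambda>e. cut_start (e 0))"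
  unfolding cut_start_def cut_init_def
  by (intro computable_subset_init decidable_cut_eps computable_intros) simp_all

lemma computable_cut_step: "computable 4 (\<lambda>e. cut_step (e 0) (e 1) (e 2, e 3))"
  unfolding cut_step_def
  by (intro computable_subset_step decidable_cut_eps decidable_cut_move computable_intros) simp_all

lemma position_start_less: "position_start v < position_bound v"
  unfolding position_start_def position_bound_def target_start_def domain_start_def cut_start_def
  by (intro prod_encode_strict_mono less_imp_le bounded_nfa.subset_init_less)

lemma position_step_less: "position_step v p x < position_bound v"
  unfolding position_step_def position_bound_def target_step_def domain_step_def cut_step_def
  by (intro prod_encode_strict_mono less_imp_le bounded_nfa.subset_step_less)

lemma decidable_winning_input: "decidable 1 (\<lambda>e. winning_input (e 0))"
  unfolding winning_input_def
proof (rule decidable_winning)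
  show "computable 1 (\<lambda>e. alphabet (e 0))"
    by (intro computable_intros) simp
  show "computable 1 (\<lambda>e. position_bound (e 0))"
    unfolding position_bound_def by (intro computable_intros) simp_all
  show "computable 1 (\<lambda>e. position_start (e 0))"
    unfolding position_start_def
    by (intro computable_prod_encode computable_target_start computable_domain_start
        computable_cut_start)
  show "computable 4 (\<lambda>e. position_step (e 0) (e 1) (e 2, e 3))"
    unfolding position_step_def
    by (intro computable_intros
        computable_comp4[of "\<lambda>v X d a. target_step v X (d, a)", OF computable_target_step]
        computable_comp4[of "\<lambda>v X d a. domain_step v X (d, a)", OF computable_domain_step]
        computable_comp4[of "\<lambda>v X d a. cut_step v X (d, a)", OF computable_cut_step]) simp_all
  show "decidable 2 (\<lambda>e. position_in_target (e 0) (e 1) \<and> position_in_relation (e 0) (e 1))"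
    unfolding position_in_target_def position_in_relation_def Let_def
    by (intro computable_intros) simp_all
  show "decidable 2 (\<lambda>e. position_in_domain (e 0) (e 1))"
    unfolding position_in_domain_def by (intro computable_intros) simp_all
qed (rule position_step_less)

lemma foldl_prod_encode:
  "foldl (\<lambda>p x. prod_encode (f (fst_decode p) x, g (snd_decode p) x)) (prod_encode (a, b)) w =
    prod_encode (foldl f a w, foldl g b w)"
  by (induction w arbitrary: a b) simp_all

lemma foldl_position_step:
  "foldl (position_step v) (position_start v) w =
    prod_encode (foldl (target_step v) (target_start v) w,
      prod_encode (foldl (domain_step v) (domain_start v) w, foldl (cut_step v) (cut_start v) w))"
  unfolding position_step_def[abs_def] position_start_def
  by (subst foldl_prod_encode) (subst foldl_prod_encode, rule refl)

section \<open>Correctness of the game of an input\<close>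

lemma dfa_wf_dfa_of: "code_valid k c \<Longrightarrow> dfa_wf k (dfa_of k c)"
  by (cases c) (auto simp: dfa_wf_def Sigma_io_def split: if_splits)

lemma states_dfa_of: "states (dfa_of k c) = {0..<num_states (encode_code c)}"
  by (cases c) simp

lemma start_state_encode_code: "start_state (encode_code c) = init (dfa_of k c)"
  by (cases c) simp

lemma code_member_final_list: "code_member q (final_list (encode_code c)) \<longleftrightarrow> q \<in> finals (dfa_of k c)"
  by (cases c) (simp add: code_member_list_encode)

lemma code_delta_encode_code:
  assumes "code_valid k c"
  shows "code_delta k (encode_code c) = (\<lambda>q x q'. delta (dfa_of k c) q x = Some q')"
proof (intro ext)
  fix q x q'
  obtain n q0 F tb where c: "c = (n, q0, F, tb)" by (cases c)
  have index: "q * (2 * k) + (fst x - 1) * k + snd x < length tb"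
    if "q < n" "fst x = 1 \<or> fst x = 2" "snd x < k"
  proof -
    have "(fst x - 1) * k + snd x < 2 * k" using that(2,3) by auto
    moreover have "Suc q * (2 * k) \<le> n * (2 * k)" using that(1) by (intro mult_le_mono1) simp
    ultimately show ?thesis using assms c by simp
  qed
  show "code_delta k (encode_code c) q x q' \<longleftrightarrow> delta (dfa_of k c) q x = Some q'"
    using code_nth_list_encode[OF index] by (cases x) (auto simp: c code_delta_def)
qed

locale uniformization_input =
  fixes k :: nat and cS cT :: dfa_code
  assumes validS: "code_valid k cS" and validT: "code_valid k cT"
    and finite_shift: "finite_shift (lang (dfa_of k cS))"
begin

abbreviation "input \<equiv> encode_input k cS cT"

lemma input_simps:
  "alphabet input = k" "source input = encode_code cS" "target input = encode_code cT"
  by (simp_all add: encode_input_def)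

sublocale source: numbered_dfa k "num_states (encode_code cS)" "dfa_of k cS"
  by unfold_locales (simp_all add: dfa_wf_dfa_of validS states_dfa_of)

sublocale target: numbered_dfa k "num_states (encode_code cT)" "dfa_of k cT"
  by unfold_locales (simp_all add: dfa_wf_dfa_of validT states_dfa_of)

lemma target_automaton:
  "target_start input = target.lang_nfa.subset_init"
  "target_step input = target.lang_nfa.subset_step"
  by (simp_all only: target_start_def target_step_def input_simps start_state_encode_code[of cT k]
      code_delta_encode_code[OF validT])

lemma domain_automaton:
  "domain_start input = source.domain_nfa.subset_init"
  "domain_step input = source.domain_nfa.subset_step"
  by (simp_all only: domain_start_def domain_step_def input_simps start_state_encode_code[of cS k]
      code_delta_encode_code[OF validS])

lemma cut_automaton:
  "cut_start input = source.cut_nfa.subset_init" "cut_step input = source.cut_nfa.subset_step"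
  by (simp_all only: cut_start_def cut_step_def input_simps start_state_encode_code[of cS k]
      code_delta_encode_code[OF validS])

abbreviation "input_position \<equiv> foldl (position_step input) (position_start input)"

lemma position_in_target_iff: "position_in_target input (input_position w) \<longleftrightarrow> w \<in> lang (dfa_of k cT)"
  by (simp add: position_in_target_def foldl_position_step target_automaton input_simps
      target.lang_nfa.foldl_subset_step_iff_run target.in_lang_iff_run
      code_member_final_list[of _ cT k])

lemma position_in_domain_iff:
  "position_in_domain input (input_position w) \<longleftrightarrow> proj_i w \<in> Domain (sem_set (lang (dfa_of k cS)))"
  by (simp add: position_in_domain_def foldl_position_step domain_automaton input_simps
      source.domain_nfa.foldl_subset_step_iff_run source.in_Domain_iff_run
      code_member_final_list[of _ cS k])

lemma position_in_relation_iff: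
  "position_in_relation input (input_position w) \<longleftrightarrow> sem w \<in> sem_set (lang (dfa_of k cS))"
  by (simp add: position_in_relation_def Let_def foldl_position_step cut_automaton input_simps
      source.cut_nfa.foldl_subset_step_iff_run source.sem_in_sem_set_iff_cut_run[OF finite_shift]
      code_member_final_list[of _ cS k])

sublocale game: synchronized_game k "position_bound input" "position_start input"
  "position_step input" "\<lambda>p. position_in_target input p \<and> position_in_relation input p"
  "position_in_domain input"
  "lang (dfa_of k cT)" "sem_set (lang (dfa_of k cS))"
proof
  show "position_start input < position_bound input"
    by (rule position_start_less)
  show "position_step input p x < position_bound input" for p x
    by (rule position_step_less)
  show "set u \<subseteq> {..<k}" if "u \<in> Domain (sem_set (lang (dfa_of k cS)))" for u
    using that set_proj_i runs_letters[OF source.wf] lang_subset_runs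
    unfolding Domain_sem_set by blast
qed (simp_all add: position_in_target_iff position_in_relation_iff position_in_domain_iff)

lemma winning_input_iff:
  "winning_input input \<longleftrightarrow> (\<exists>A. dfa_wf k A \<and> sequential A \<and> lang A \<subseteq> lang (dfa_of k cT) \<and>
     uniformization (sem_set (lang A)) (sem_set (lang (dfa_of k cS))))"
  unfolding winning_input_def input_simps by (rule game.winning_iff_ex_sequential_uniformizer)

end

theorem theoremA1:
  shows "\<exists>f::recf. \<forall>k cS cT.
     code_valid k cS \<and> code_valid k cT \<and> finite_shift (lang (dfa_of k cS)) \<longrightarrow>
     eval f [encode_input k cS cT]
       (if (\<exists>A. dfa_wf k A \<and> sequential A \<and> lang A \<subseteq> lang (dfa_of k cT) \<and>
              uniformization (sem_set (lang A)) (sem_set (lang (dfa_of k cS))))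
        then 1 else 0)"
proof -
  obtain f where f: "\<And>e. eval f (map e [0..<1]) (of_bool (winning_input (e 0)))"
    using decidable_winning_input unfolding computable_def by blast
  show ?thesis
  proof (intro exI[of _ f] allI impI, elim conjE)
    fix k cS cT
    assume "code_valid k cS" "code_valid k cT" "finite_shift (lang (dfa_of k cS))"
    then interpret uniformization_input k cS cT by unfold_locales
    show "eval f [encode_input k cS cT]
       (if (\<exists>A. dfa_wf k A \<and> sequential A \<and> lang A \<subseteq> lang (dfa_of k cT) \<and>
              uniformization (sem_set (lang A)) (sem_set (lang (dfa_of k cS))))
        then 1 else 0)"
      using f[of "\<lambda>_. input"] by (simp add: winning_input_iff of_bool_def)
  qed
qed

end
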